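(* For generic $a\in\mathbb{C}^*$ (so that all terms are defined), $$\Big(1+\frac1a\Big)\sum_{n=0}^{\infty}\frac{(-aq;q)_n(-q/a;q)_n\,q^{n+1}}{(q;q^2)_{n+1}}=-m(a,q,-1)+\frac{j(-a;q)}{j(q;q^2)}\,m(a^2,q^2,-1)-a\frac{J_4^3}{J_2^3}\frac{j(a;q)\,j(qa^2;q^2)}{j(a^4;q^4)}.$$
   Context: $q$ is a complex number with $0<|q|<1$. $(x;q)_n=\prod_{i=0}^{n-1}(1-xq^i)$, $(x;q)_\infty=\prod_{i\ge0}(1-xq^i)$, $j(x;q)=(x;q)_\infty(q/x;q)_\infty(q;q)_\infty$, and $J_m=(q^m;q^m)_\infty$. The Appell--Lerch sum is $m(x,q,z)=\frac{1}{j(z;q)}\sum_{r\in\mathbb{Z}}\frac{(-1)^rq^{\binom r2}z^r}{1-q^{r-1}xz}$. *)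

theory Defs
  imports "HOL-Analysis.Analysis"
begin

definition qpoch :: "complex \<Rightarrow> complex \<Rightarrow> nat \<Rightarrow> complex" where
  "qpoch x q n = (\<Prod>i<n. 1 - x * q ^ i)"

(* For norm q < 1 the product converges for every x; prodinf admits finitely
   many vanishing factors, in which case its value is 0. *)
definition qpoch_inf :: "complex \<Rightarrow> complex \<Rightarrow> complex" where
  "qpoch_inf x q = (\<Prod>i. 1 - x * q ^ i)"

definition jtheta :: "complex \<Rightarrow> complex \<Rightarrow> complex" where
  "jtheta x q = qpoch_inf x q * qpoch_inf (q / x) q * qpoch_inf q q"

definition Jprod :: "nat \<Rightarrow> complex \<Rightarrow> complex" where
  "Jprod m q = qpoch_inf (q ^ m) (q ^ m)"

(* The binomial coefficient r(r-1)/2 is a nonnegative integer for every integer r,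
   so the integer division is exact. The bilateral sum is an unconditional
   (equivalently, absolutely convergent) sum over all integers. *)
definition appell_m :: "complex \<Rightarrow> complex \<Rightarrow> complex \<Rightarrow> complex" where
  "appell_m x q z =
     1 / jtheta z q *
     (\<Sum>\<^sub>\<infinity>r::int. (-1) powi r * q powi (r * (r - 1) div 2) * z powi r
                 / (1 - q powi (r - 1) * x * z))"

end

theory Submission
  imports Defs "HOL-Complex_Analysis.Complex_Analysis"
begin

text \<open>Let \<open>D(a)\<close> be the difference of the two sides. A telescoping sum for the left-hand
  side and \<open>m(qx,q,-1) = 1 - x m(x,q,-1)\<close> (which rests on Gauss's evaluation
  \<open>\<Sum> q\<^bsup>s(s+1)/2\<^esup> = j(-1;q)\<close>) give \<open>D(qa) = -a D(a)\<close>. The only possible poles of \<open>D\<close>, up to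
  multiplication by powers of \<open>q\<close>, are simple poles at \<open>-1\<close> and \<open>\<plusminus>i\<close>, and there the residues
  cancel. Iterating the functional equation shows that \<open>D\<close> is bounded near \<open>0\<close>, so it extends
  holomorphically to \<open>0\<close>, and the functional equation forbids a finite order of vanishing.\<close>

section \<open>Infinite products and theta functions\<close>

text \<open>The equation \<open>D(qa) = -a D(a)\<close> alone proves nothing: 1/j(a;q) satisfies it
  too. What excludes such solutions is the absence of poles, so the exact cancellation of the
  residues carries the proof. The theta quotient solves the homogeneous equation by itself; its task
  is to cancel the poles brought in by the Appell-Lerch sums, at -1 by m(a,q,-1) and at i and -i by
  m(a^2,q^2,-1). The zeros of j(a^4;q^4) at powers of q do no harm, because j(a;q) vanishes there as
  well. The direction of the equation matters: its factor has modulus at most 1 on the unit disc, so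
  moving towards 0 never increases |D|. The formal obstacle is that division by zero gives D
  arbitrary values at the excluded points, so D must be replaced by its analytic continuation before
  complex analysis applies.\<close>

lemma convergent_prod_qpoch:
  fixes x q :: complex
  assumes "norm q < 1"
  shows "convergent_prod (\<lambda>i. 1 - x * q ^ i)"
proof -
  have "summable (\<lambda>i. norm ((1 - x * q ^ i) - 1))"
    using assms by (auto simp: norm_mult norm_power intro!: summable_mult summable_geometric)
  then show ?thesis
    by (intro abs_convergent_prod_imp_convergent_prod summable_imp_abs_convergent_prod)
qed

lemma qpoch_tendsto:
  assumes "norm q < 1"
  shows "qpoch x q \<longlonglongrightarrow> qpoch_inf x q"
proof -
  have "(\<lambda>n. \<Prod>i\<le>n. 1 - x * q ^ i) \<longlonglongrightarrow> qpoch_inf x q"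
    unfolding qpoch_inf_def by (rule convergent_prod_LIMSEQ[OF convergent_prod_qpoch[OF assms]])
  then have "(\<lambda>n. qpoch x q (Suc n)) \<longlonglongrightarrow> qpoch_inf x q"
    by (simp add: qpoch_def lessThan_Suc_atMost)
  then show ?thesis
    by (rule LIMSEQ_imp_Suc)
qed

lemma qpoch_inf_nonzero:
  assumes "norm q < 1" "\<And>i. x * q ^ i \<noteq> 1"
  shows "qpoch_inf x q \<noteq> 0"
  unfolding qpoch_inf_def using assms(2)
  by (intro prodinf_nonzero convergent_prod_qpoch[OF assms(1)]) auto

lemma qpoch_0 [simp]: "qpoch x q 0 = 1"
  by (simp add: qpoch_def)

lemma qpoch_Suc: "qpoch x q (Suc n) = qpoch x q n * (1 - x * q ^ n)"
  by (simp add: qpoch_def)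

lemma qpoch_Suc_shift: "qpoch x q (Suc n) = (1 - x) * qpoch (x * q) q n"
  unfolding qpoch_def by (subst prod.lessThan_Suc_shift) (simp add: mult.assoc)

lemma qpoch_eq_0_iff: "qpoch x q n = 0 \<longleftrightarrow> (\<exists>i<n. x * q ^ i = 1)"
  by (auto simp: qpoch_def)

lemma qpoch_inf_shift:
  assumes "norm q < 1"
  shows "qpoch_inf x q = (1 - x) * qpoch_inf (x * q) q"
proof (rule LIMSEQ_unique)
  show "(\<lambda>n. qpoch x q (Suc n)) \<longlonglongrightarrow> qpoch_inf x q"
    by (rule LIMSEQ_Suc[OF qpoch_tendsto[OF assms]])
  show "(\<lambda>n. qpoch x q (Suc n)) \<longlonglongrightarrow> (1 - x) * qpoch_inf (x * q) q"
    unfolding qpoch_Suc_shift by (intro tendsto_intros qpoch_tendsto assms)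
qed

lemma qpoch_inf_mult_minus:
  assumes "norm q < 1"
  shows "qpoch_inf x q * qpoch_inf (- x) q = qpoch_inf (x\<^sup>2) (q\<^sup>2)"
  unfolding qpoch_inf_def
  by (subst prodinf_mult[OF convergent_prod_qpoch[OF assms] convergent_prod_qpoch[OF assms]])
     (auto intro!: prodinf_cong simp: power2_eq_square algebra_simps)

lemma qpoch_double:
  "qpoch x q (2 * n) = qpoch x (q\<^sup>2) n * qpoch (x * q) (q\<^sup>2) n"
  by (induction n) (auto simp: qpoch_Suc algebra_simps simp flip: power_mult)

lemma norm_power_less_one:
  fixes q :: complex
  assumes "norm q < 1" "0 < k"
  shows "norm (q ^ k) < 1"
  using assms by (simp add: norm_power power_less_one_iff)

lemma qpoch_inf_double:
  assumes "norm q < 1"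
  shows "qpoch_inf x q = qpoch_inf x (q\<^sup>2) * qpoch_inf (x * q) (q\<^sup>2)"
proof (rule LIMSEQ_unique)
  have q2: "norm (q\<^sup>2) < 1"
    using assms by (simp add: norm_power_less_one)
  have "filterlim (\<lambda>n::nat. 2 * n) at_top at_top"
    by (rule filterlim_subseq) (simp add: strict_mono_def)
  then show "(\<lambda>n. qpoch x q (2 * n)) \<longlonglongrightarrow> qpoch_inf x q"
    by (rule filterlim_compose[OF qpoch_tendsto[OF assms]])
  show "(\<lambda>n. qpoch x q (2 * n)) \<longlonglongrightarrow> qpoch_inf x (q\<^sup>2) * qpoch_inf (x * q) (q\<^sup>2)"
    unfolding qpoch_double by (intro tendsto_intros qpoch_tendsto q2)
qed

text \<open>Each factor is at most the exponential of \<open>r * norm q ^ i\<close>, and these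
  exponents form a geometric series. The bound is independent of \<open>n\<close> and of the
  position of \<open>x\<close> in the disc, as the Weierstrass test for the mock theta series
  requires.\<close>

lemma norm_qpoch_le:
  assumes "norm q < 1" "norm x \<le> r"
  shows "norm (qpoch x q n) \<le> exp (r / (1 - norm q))"
proof -
  have r: "0 \<le> r"
    using assms(2) norm_ge_zero order_trans by blast
  have "norm (qpoch x q n) = (\<Prod>i<n. norm (1 - x * q ^ i))"
    by (simp add: qpoch_def prod_norm)
  also have "\<dots> \<le> (\<Prod>i<n. exp (r * norm q ^ i))"
  proof (rule prod_mono, safe)
    fix i
    have "norm (1 - x * q ^ i) \<le> 1 + norm (x * q ^ i)"
      by (metis norm_one norm_triangle_ineq4)
    also have "\<dots> \<le> 1 + r * norm q ^ i"
      using assms(2) by (simp add: norm_mult norm_power mult_right_mono)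
    also have "\<dots> \<le> exp (r * norm q ^ i)"
      by (rule exp_ge_add_one_self)
    finally show "norm (1 - x * q ^ i) \<le> exp (r * norm q ^ i)" .
  qed auto
  also have "\<dots> = exp (r * (\<Sum>i<n. norm q ^ i))"
    by (simp add: exp_sum sum_distrib_left)
  also have "(\<Sum>i<n. norm q ^ i) \<le> (\<Sum>i. norm q ^ i)"
    using assms(1) by (intro sum_le_suminf summable_geometric) auto
  also have "(\<Sum>i. norm q ^ i) = 1 / (1 - norm q)"
    using assms(1) by (intro suminf_geometric) auto
  finally show ?thesis
    using r by (simp add: mult_left_mono)
qed

lemma holomorphic_qpoch_inf:
  assumes "norm q < 1"
  shows "(\<lambda>x. qpoch_inf x q) holomorphic_on UNIV"
proof (rule holomorphic_uniform_sequence[where f = "\<lambda>n x. qpoch x q n"])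
  show "(\<lambda>x. qpoch x q n) holomorphic_on UNIV" for n
    unfolding qpoch_def by (intro holomorphic_intros)
  fix x :: complex
  have "uniformly_convergent_on (cball x 1) (\<lambda>N y. \<Prod>i<N. 1 - y * q ^ i)"
  proof (rule uniformly_convergent_on_prod')
    show "continuous_on (cball x 1) (\<lambda>y. 1 - y * q ^ n)" for n
      by (intro continuous_intros)
    show "uniformly_convergent_on (cball x 1) (\<lambda>N y. \<Sum>i<N. norm (1 - y * q ^ i - 1))"
    proof (rule Weierstrass_m_test')
      show "summable (\<lambda>i. (norm x + 1) * norm q ^ i)"
        using assms by (intro summable_mult summable_geometric) auto
      fix n y assume "y \<in> cball x 1"
      then have "norm y \<le> norm x + 1"
        by (simp add: dist_norm) (smt (verit) norm_triangle_sub norm_minus_commute)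
      then show "norm (norm (1 - y * q ^ n - 1)) \<le> (norm x + 1) * norm q ^ n"
        by (simp add: norm_mult norm_power mult_right_mono)
    qed
  qed auto
  then obtain l where l: "uniform_limit (cball x 1) (\<lambda>N y. qpoch y q N) l sequentially"
    unfolding uniformly_convergent_on_def qpoch_def by blast
  moreover have "l y = qpoch_inf y q" if "y \<in> cball x 1" for y
    using tendsto_uniform_limitI[OF l that] qpoch_tendsto[OF assms] LIMSEQ_unique by blast
  ultimately have "uniform_limit (cball x 1) (\<lambda>N y. qpoch y q N) (\<lambda>y. qpoch_inf y q) sequentially"
    using uniform_limit_cong'[of "cball x 1"] by (metis (no_types, lifting))
  then show "\<exists>d>0. cball x d \<subseteq> UNIV \<and>
      uniform_limit (cball x d) (\<lambda>n x. qpoch x q n) (\<lambda>x. qpoch_inf x q) sequentially"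
    by (intro exI[of _ 1]) auto
qed auto

lemma holomorphic_qpoch_inf_comp [holomorphic_intros]:
  assumes "norm q < 1" "f holomorphic_on S"
  shows "(\<lambda>z. qpoch_inf (f z) q) holomorphic_on S"
  using holomorphic_on_compose_gen[OF assms(2) holomorphic_qpoch_inf[OF assms(1)]]
  by (simp add: o_def)

section \<open>Theta functions: quasi-periodicity, zeros and special values\<close>

lemma jtheta_shift:
  assumes "norm q < 1" "q \<noteq> 0" "x \<noteq> 0"
  shows "jtheta (q * x) q = - jtheta x q / x"
proof -
  have "qpoch_inf x q = (1 - x) * qpoch_inf (q * x) q"
    using qpoch_inf_shift[OF assms(1), of x] by (simp add: mult.commute)
  moreover have "qpoch_inf (q / (q * x)) q = (1 - 1 / x) * qpoch_inf (q / x) q"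
    using qpoch_inf_shift[OF assms(1), of "1 / x"] assms by simp
  ultimately show ?thesis
    unfolding jtheta_def using assms(3) by (simp only:) (simp add: field_simps)
qed

lemma jtheta_nonzero:
  assumes "norm q < 1" "0 < norm q" "x \<noteq> 0" "\<And>k::int. x \<noteq> q powi k"
  shows "jtheta x q \<noteq> 0"
proof -
  have "q \<noteq> 0" using assms by auto
  have "x * q ^ i \<noteq> 1" for i
    using assms(4)[of "- int i"] \<open>q \<noteq> 0\<close> by (auto simp: power_int_minus field_simps)
  moreover have "q / x * q ^ i \<noteq> 1" for i
    using assms(4)[of "int (Suc i)"] \<open>q \<noteq> 0\<close> assms(3) unfolding power_int_of_nat
    by (auto simp: field_simps)
  moreover have "q * q ^ i \<noteq> 1" for i
    using norm_power_less_one[OF assms(1), of "Suc i"] by (metis norm_one order_less_irrefl power_Suc zero_less_Suc)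
  ultimately show ?thesis
    unfolding jtheta_def using assms(1) by (simp add: qpoch_inf_nonzero)
qed

lemma qpoch_inf_q_nonzero:
  assumes "norm q < 1" "0 < k"
  shows "qpoch_inf (q ^ k) (q ^ k) \<noteq> 0"
proof (rule qpoch_inf_nonzero)
  show qk: "norm (q ^ k) < 1"
    using assms by (rule norm_power_less_one)
  show "q ^ k * (q ^ k) ^ i \<noteq> 1" for i
    using norm_power_less_one[OF qk, of "Suc i"] by (metis norm_one order_less_irrefl power_Suc zero_less_Suc)
qed

lemma Jprod_nonzero:
  assumes "norm q < 1" "0 < k"
  shows "Jprod k q \<noteq> 0"
  unfolding Jprod_def by (rule qpoch_inf_q_nonzero[OF assms])

text \<open>Special products are reduced to monomials in the \<open>Jprod m q\<close>, so that the
  residue conditions at the end become identities between such monomials. Here (q;q)(-q;q) =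
  (q^2;q^2).\<close>

lemma qpoch_inf_minus_q:
  assumes "norm q < 1"
  shows "qpoch_inf (- q) q = Jprod 2 q / Jprod 1 q"
  using qpoch_inf_mult_minus[OF assms, of q] Jprod_nonzero[OF assms, of 1]
  by (simp add: Jprod_def field_simps)

lemma qpoch_inf_q_q2:
  assumes "norm q < 1"
  shows "qpoch_inf q (q\<^sup>2) = Jprod 1 q / Jprod 2 q"
  using qpoch_inf_double[OF assms, of q] Jprod_nonzero[OF assms, of 2]
  by (simp add: Jprod_def field_simps power2_eq_square)

lemma jtheta_minus_one:
  assumes "norm q < 1"
  shows "jtheta (- 1) q = 2 * (Jprod 2 q)\<^sup>2 / Jprod 1 q"
proof -
  have "qpoch_inf (- 1) q = 2 * qpoch_inf (- q) q"
    using qpoch_inf_shift[OF assms, of "- 1"] by simp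
  moreover have "qpoch_inf q q = Jprod 1 q"
    by (simp add: Jprod_def)
  ultimately show ?thesis
    using Jprod_nonzero[OF assms, of 1]
    by (simp add: jtheta_def qpoch_inf_minus_q[OF assms] power2_eq_square)
qed

lemma jtheta_q_q2:
  assumes "norm q < 1" "q \<noteq> 0"
  shows "jtheta q (q\<^sup>2) = (Jprod 1 q)\<^sup>2 / Jprod 2 q"
proof -
  have "q\<^sup>2 / q = q" using assms by (simp add: power2_eq_square)
  then show ?thesis
    using qpoch_inf_q_q2[OF assms(1)] Jprod_nonzero[OF assms(1), of 2]
    by (simp add: jtheta_def Jprod_def[of 2] field_simps power2_eq_square)
qed

section \<open>Gauss's theta series\<close>

lemma qpoch_q_q2_nonzero:
  fixes q :: complex
  assumes "norm q < 1"
  shows "qpoch q (q\<^sup>2) n \<noteq> 0"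
proof -
  have e: "q * (q\<^sup>2) ^ i = q ^ (2 * i + 1)" for i
    by (simp add: power_mult)
  have "q ^ (2 * i + 1) \<noteq> 1" for i
    using norm_power_less_one[OF assms, of "2 * i + 1"] by auto
  then show ?thesis
    unfolding qpoch_eq_0_iff e by blast
qed

text \<open>Shanks' finite form of Gauss's identity. As \<open>n\<close> grows, only the term \<open>s = 0\<close> survives on the
  right.\<close>

lemma Shanks_identity:
  fixes q :: complex
  assumes q: "norm q < 1"
  defines "P \<equiv> \<lambda>n. qpoch (q\<^sup>2) (q\<^sup>2) n / qpoch q (q\<^sup>2) n"
  shows "(\<Sum>k<2 * n. q ^ (k * (k + 1) div 2)) = (\<Sum>s<n. P n / P s * q ^ (s * (2 * n + 1)))"
proof -
  have ne: "1 - q ^ m \<noteq> 0" if "0 < m" for m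
    using norm_power_less_one[OF q that] by auto
  have [simp]: "qpoch q (q\<^sup>2) n \<noteq> 0" for n
    by (rule qpoch_q_q2_nonzero[OF q])
  have [simp]: "qpoch (q\<^sup>2) (q\<^sup>2) n \<noteq> 0" for n
  proof -
    have "(q\<^sup>2) ^ Suc i \<noteq> 1" for i
      using ne[of "2 * Suc i"] unfolding power_mult by auto
    then show ?thesis
      unfolding qpoch_eq_0_iff power_Suc[symmetric] by blast
  qed
  have Pne: "P n \<noteq> 0" for n
    by (simp add: P_def)
  have P_Suc: "P (Suc n) = P n * ((1 - q ^ (2 * n + 2)) / (1 - q ^ (2 * n + 1)))" for n
    by (simp add: P_def qpoch_Suc power_mult power_add power2_eq_square)
  show ?thesis
  proof (induction n)
    case 0
    then show ?case by simp
  next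
    case (Suc n)
    define t where "t = q ^ (2 * n + 1)"
    \<comment> \<open>A Wilf-Zeilberger mate: the change of the summand from \<open>n\<close> to
      \<open>Suc n\<close> is a difference of \<open>H\<close> in \<open>s\<close>. The factor
      \<open>1 - q ^ (2 * s)\<close> makes \<open>H 0\<close> vanish.\<close>
    define H where "H s = P n / P s * t ^ s * (1 - q ^ (2 * s)) / (1 - t)" for s
    have t1: "1 - t \<noteq> 0"
      unfolding t_def by (rule ne) simp
    have step: "P (Suc n) / P s * q ^ (s * (2 * Suc n + 1)) - P n / P s * q ^ (s * (2 * n + 1)) = H (Suc s) - H s" for s
    proof -
      define x where "x = q ^ (2 * s)"
      have xs: "q ^ (2 * s + 2) = q * q * x" "q ^ (2 * s + 1) = q * x" "q ^ (2 * n + 2) = q * t"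
        "q ^ (2 * n + 1) = t" "q ^ (2 * Suc s) = q * q * x"
        by (simp_all add: x_def t_def power_add mult.commute)
      have "s * (2 * n + 1) = (2 * n + 1) * s" "s * (2 * Suc n + 1) = (2 * n + 1) * s + 2 * s"
        by (simp_all add: algebra_simps)
      then have ts: "q ^ (s * (2 * n + 1)) = t ^ s" "q ^ (s * (2 * Suc n + 1)) = t ^ s * x"
        by (simp_all only: t_def x_def power_mult power_add)
      have nz: "1 - q * q * x \<noteq> 0" "1 - q * x \<noteq> 0"
        using ne[of "2 * s + 2"] ne[of "2 * s + 1"] unfolding xs by simp_all
      define r where "r = P n / P s"
      have H_Suc: "H (Suc s) = r * t ^ s * (t * (1 - q * x)) / (1 - t)"
      proof -
        have "a / (p * (d / e)) * (t * T) * d / u = a / p * T * (t * e) / u" if "d \<noteq> 0" for a p d e T u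
          using that by (cases "e = 0"; cases "p = 0") auto
        from this[OF nz(1)] show ?thesis
          unfolding H_def P_Suc xs r_def power_Suc .
      qed
      have H: "H s = r * t ^ s * (1 - x) / (1 - t)"
        unfolding H_def r_def x_def ..
      have P: "P (Suc n) / P s = r * (1 - q * t) / (1 - t)"
        unfolding P_Suc xs r_def by simp
      show ?thesis
        unfolding H H_Suc P ts r_def[symmetric] using t1
        by (simp add: divide_simps) (simp add: algebra_simps)
    qed
    have "(\<Sum>s<Suc n. P (Suc n) / P s * q ^ (s * (2 * Suc n + 1))) =
        (\<Sum>s<Suc n. P n / P s * q ^ (s * (2 * n + 1))) + (\<Sum>s<Suc n. H (Suc s) - H s)"
      by (simp only: step[symmetric] sum.distrib[symmetric]) simp
    also have "(\<Sum>s<Suc n. H (Suc s) - H s) = H (Suc n) - H 0"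
      by (rule sum_lessThan_telescope)
    also have "\<dots> = t ^ Suc n"
    proof -
      have "q ^ (2 * Suc n) = q * t" by (simp add: t_def)
      moreover have "P (Suc n) = P n * ((1 - q * t) / (1 - t))"
        by (simp add: P_Suc t_def)
      moreover have "1 - q * t \<noteq> 0" using ne[of "2 * n + 2"] by (simp add: t_def)
      ultimately show ?thesis
        using t1 Pne[of n] by (simp add: H_def divide_simps)
    qed
    \<comment> \<open>The extra term \<open>s = n\<close> has quotient 1, and its exponent is the
      triangular number of \<open>2 * n\<close>; the boundary term \<open>t ^ Suc n\<close> supplies
      that of \<open>2 * n + 1\<close>. These are the two new terms of the theta series.\<close>
    also have "(\<Sum>s<Suc n. P n / P s * q ^ (s * (2 * n + 1))) =
        (\<Sum>k<2 * n. q ^ (k * (k + 1) div 2)) + q ^ (n * (2 * n + 1))"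
      using Pne[of n] Suc.IH by simp
    also have "q ^ (n * (2 * n + 1)) = q ^ (2 * n * (2 * n + 1) div 2)"
    proof -
      have "2 * n * (2 * n + 1) = 2 * (n * (2 * n + 1))" by simp
      then show ?thesis by (simp only: nonzero_mult_div_cancel_left)
    qed
    also have "t ^ Suc n = q ^ (Suc (2 * n) * (Suc (2 * n) + 1) div 2)"
    proof -
      have "Suc (2 * n) * (Suc (2 * n) + 1) = 2 * ((2 * n + 1) * Suc n)" by simp
      then show ?thesis unfolding t_def power_mult[symmetric] by (simp only: nonzero_mult_div_cancel_left)
    qed
    finally have "(\<Sum>s<Suc n. P (Suc n) / P s * q ^ (s * (2 * Suc n + 1))) =
        (\<Sum>k<Suc (Suc (2 * n)). q ^ (k * (k + 1) div 2))"
      by (simp only: sum.lessThan_Suc)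
    then show ?case
      by (simp only: mult_Suc_right) simp
  qed
qed

lemma triangle_ge: "k \<le> k * (k + 1) div (2::nat)"
  by (induction k) auto

lemma summable_theta:
  fixes x :: real
  assumes "0 \<le> x" "x < 1"
  shows "summable (\<lambda>k. x ^ (k * (k + 1) div 2))"
proof (rule summable_comparison_test')
  show "summable (\<lambda>k. x ^ k)" using assms by simp
  show "norm (x ^ (k * (k + 1) div 2)) \<le> x ^ k" for k
    using assms power_decreasing[OF triangle_ge[of k], of x] by simp
qed

lemma Gauss_theta_sums:
  fixes q :: complex
  assumes q: "norm q < 1"
  shows "(\<lambda>k. q ^ (k * (k + 1) div 2)) sums ((Jprod 2 q)\<^sup>2 / Jprod 1 q)"
proof -
  define P where "P n = qpoch (q\<^sup>2) (q\<^sup>2) n / qpoch q (q\<^sup>2) n" for n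
  define L where "L = (Jprod 2 q)\<^sup>2 / Jprod 1 q"
  have q2: "norm (q\<^sup>2) < 1" using q by (simp add: norm_power_less_one)
  have J: "Jprod 2 q \<noteq> 0" "Jprod 1 q \<noteq> 0" using Jprod_nonzero[OF q] by auto
  have "P \<longlonglongrightarrow> qpoch_inf (q\<^sup>2) (q\<^sup>2) / qpoch_inf q (q\<^sup>2)"
    unfolding P_def using J by (intro tendsto_intros qpoch_tendsto q2) (simp add: qpoch_inf_q_q2[OF q])
  then have P: "P \<longlonglongrightarrow> L"
    unfolding qpoch_inf_q_q2[OF q] Jprod_def[of 2, symmetric]
    by (simp add: L_def power2_eq_square)
  have L: "L \<noteq> 0" using J by (simp add: L_def)
  \<comment> \<open>As \<open>L\<close> is nonzero, both \<open>P\<close> and its inverse are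
    bounded, so \<open>P n / P s\<close> is bounded uniformly in both indices.\<close>
  obtain A where A: "\<And>n. norm (P n) \<le> A"
    using convergent_imp_Bseq[OF convergentI[OF P]] by (auto simp: Bseq_def)
  obtain B where B: "\<And>n. norm (inverse (P n)) \<le> B"
    using convergent_imp_Bseq[OF convergentI[OF tendsto_inverse[OF P L]]] by (auto simp: Bseq_def)
  have AB: "0 \<le> A" "0 \<le> B"
    using order_trans[OF norm_ge_zero A] order_trans[OF norm_ge_zero B] by auto
  let ?R = "\<lambda>n. \<Sum>s\<in>{1..<n}. P n / P s * q ^ (s * (2 * n + 1))"
  have R: "norm (?R n) \<le> A * B / (1 - norm q) * norm q ^ n" for n
  proof -
    have "norm (?R n) \<le> (\<Sum>s\<in>{1..<n}. A * B * (norm q ^ n * norm q ^ s))"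
    proof (rule sum_norm_le)
      fix s assume s: "s \<in> {1..<n}"
      \<comment> \<open>This uses \<open>s\<close> at least 1. It splits off a factor
        \<open>norm q ^ n\<close> that tends to 0 and leaves a geometric series in
        \<open>s\<close>.\<close>
      then have "n + s \<le> s * (2 * n + 1)"
        by (cases s) auto
      then have "norm q ^ (s * (2 * n + 1)) \<le> norm q ^ (n + s)"
        using q by (intro power_decreasing) auto
      then show "norm (P n / P s * q ^ (s * (2 * n + 1))) \<le> A * B * (norm q ^ n * norm q ^ s)"
        using A[of n] B[of s] AB unfolding divide_inverse norm_mult norm_power power_add[symmetric]
        by (intro mult_mono) auto
    qed
    also have "\<dots> = A * B * norm q ^ n * (\<Sum>s\<in>{1..<n}. norm q ^ s)"
      by (simp add: sum_distrib_left mult.assoc)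
    also have "\<dots> \<le> A * B * norm q ^ n * (\<Sum>s. norm q ^ s)"
      using q AB by (intro mult_left_mono sum_le_suminf summable_geometric) auto
    also have "(\<Sum>s. norm q ^ s) = 1 / (1 - norm q)"
      using q by (intro suminf_geometric) auto
    finally show ?thesis
      by simp
  qed
  have "(\<lambda>n. A * B / (1 - norm q) * norm q ^ n) \<longlonglongrightarrow> A * B / (1 - norm q) * 0"
    using q by (intro tendsto_intros) auto
  then have "(\<lambda>n. A * B / (1 - norm q) * norm q ^ n) \<longlonglongrightarrow> 0"
    by simp
  then have "?R \<longlonglongrightarrow> 0"
    by (rule Lim_null_comparison[rotated]) (intro always_eventually allI R)
  then have "(\<lambda>n. P n + ?R n) \<longlonglongrightarrow> L + 0"
    by (intro tendsto_add P)
  moreover have "\<forall>\<^sub>F n in sequentially. P n + ?R n = (\<Sum>k<2 * n. q ^ (k * (k + 1) div 2))"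
  proof (rule eventually_mono[OF eventually_gt_at_top[of 0]])
    fix n :: nat assume "0 < n"
    then have "{..<n} = insert 0 {1..<n}" by auto
    then show "P n + ?R n = (\<Sum>k<2 * n. q ^ (k * (k + 1) div 2))"
      unfolding Shanks_identity[OF q] P_def[symmetric] by (simp add: P_def[of 0])
  qed
  ultimately have lim: "(\<lambda>n. \<Sum>k<2 * n. q ^ (k * (k + 1) div 2)) \<longlonglongrightarrow> L"
    unfolding add_0_right by (rule Lim_transform_eventually)
  \<comment> \<open>The finite identity controls only partial sums of even length; convergence of
    the full series identifies its sum with their limit.\<close>
  have "summable (\<lambda>k. q ^ (k * (k + 1) div 2))"
    using summable_theta[of "norm q"] q by (simp add: norm_power summable_norm_cancel)
  then obtain M where M: "(\<lambda>k. q ^ (k * (k + 1) div 2)) sums M"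
    by (auto simp: summable_def)
  have "filterlim (\<lambda>n::nat. 2 * n) at_top at_top"
    by (rule filterlim_subseq) (simp add: strict_mono_def)
  from filterlim_compose[OF M[unfolded sums_def] this] lim have "M = L"
    by (rule LIMSEQ_unique)
  with M show ?thesis by (simp add: L_def)
qed

section \<open>The Appell--Lerch sum at \<open>z = -1\<close>\<close>

text \<open>The cut between -1 and 0 suits the reflection of \<open>s\<close> to
  \<open>- 1 - s\<close>, which fixes \<open>s * (s + 1) div 2\<close>: both halves of the bilateral
  theta series are then the same one-sided series.\<close>

lemma has_sum_int_split:
  fixes f :: "int \<Rightarrow> 'a :: {topological_comm_monoid_add}"
  assumes "((\<lambda>n. f (int n)) has_sum A) UNIV" "((\<lambda>n. f (- 1 - int n)) has_sum B) UNIV"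
  shows "(f has_sum (A + B)) UNIV"
proof -
  have "(f has_sum A) (range int)"
    using assms(1) by (subst has_sum_reindex) (auto simp: o_def)
  moreover have "(f has_sum B) (range (\<lambda>n. - 1 - int n))"
    using assms(2) by (subst has_sum_reindex) (auto simp: o_def inj_on_def)
  moreover have "range int \<inter> range (\<lambda>n. - 1 - int n) = {}"
    by auto
  ultimately have "(f has_sum (A + B)) (range int \<union> range (\<lambda>n. - 1 - int n))"
    by (intro has_sum_Un_disjoint) auto
  moreover have "i \<in> range int \<union> range (\<lambda>n. - 1 - int n)" for i
  proof (cases "0 \<le> i")
    case True
    then show ?thesis using range_eqI[of i int "nat i"] by simp
  next
    case False
    then show ?thesis using range_eqI[of i "\<lambda>n. - 1 - int n" "nat (- 1 - i)"] by simp
  qed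
  then have "range int \<union> range (\<lambda>n. - 1 - int n) = UNIV"
    by blast
  ultimately show ?thesis
    by simp
qed

lemma triangle_int:
  "int n * (int n + 1) div 2 = int (n * (n + 1) div 2)"
  "(- 1 - int n) * ((- 1 - int n) + 1) div 2 = int (n * (n + 1) div 2)"
proof -
  show "int n * (int n + 1) div 2 = int (n * (n + 1) div 2)"
    by (simp add: zdiv_int algebra_simps)
  moreover have "(- 1 - int n) * ((- 1 - int n) + 1) = int n * (int n + 1)"
    by (simp add: algebra_simps)
  ultimately show "(- 1 - int n) * ((- 1 - int n) + 1) div 2 = int (n * (n + 1) div 2)"
    by simp
qed

lemma summable_on_int_theta:
  fixes x :: real
  assumes "0 \<le> x" "x < 1"
  shows "(\<lambda>s::int. x powi (s * (s + 1) div 2)) summable_on UNIV"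
proof -
  have *: "((\<lambda>n. x ^ (n * (n + 1) div 2)) has_sum (\<Sum>n. x ^ (n * (n + 1) div 2))) UNIV"
    using summable_theta[OF assms] assms(1)
    by (intro norm_summable_imp_has_sum) (auto simp: summable_sums)
  show ?thesis
    by (rule has_sum_imp_summable[OF has_sum_int_split])
       (use * in \<open>simp_all only: triangle_int power_int_of_nat\<close>)
qed

text \<open>Twice Gauss's series, and 2 J_2^2 / J_1 is the product form of j(-1;q): the Jacobi
  triple product at -1.\<close>

lemma infsum_int_theta:
  fixes q :: complex
  assumes "norm q < 1"
  shows "(\<Sum>\<^sub>\<infinity>s::int. q powi (s * (s + 1) div 2)) = jtheta (- 1) q"
proof (rule infsumI)
  have "summable (\<lambda>k. norm (q ^ (k * (k + 1) div 2)))"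
    using summable_theta[of "norm q"] assms by (simp add: norm_power)
  then have *: "((\<lambda>k. q ^ (k * (k + 1) div 2)) has_sum ((Jprod 2 q)\<^sup>2 / Jprod 1 q)) UNIV"
    by (rule norm_summable_imp_has_sum[OF _ Gauss_theta_sums[OF assms]])
  have "((\<lambda>s::int. q powi (s * (s + 1) div 2)) has_sum
      ((Jprod 2 q)\<^sup>2 / Jprod 1 q + (Jprod 2 q)\<^sup>2 / Jprod 1 q)) UNIV"
    by (rule has_sum_int_split) (use * in \<open>simp_all only: triangle_int power_int_of_nat\<close>)
  then show "((\<lambda>s::int. q powi (s * (s + 1) div 2)) has_sum jtheta (- 1) q) UNIV"
    by (simp add: jtheta_minus_one[OF assms])
qed

text \<open>The bilateral sum of \<open>appell_m\<close> at \<open>z = - 1\<close> without its theta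
  prefactor. There the two signs cancel, and the index shift r = s + 1 makes \<open>s = 0\<close>
  the term with its pole at \<open>x = - 1\<close>.\<close>

definition lerch :: "complex \<Rightarrow> complex \<Rightarrow> complex" where
  "lerch q x = (\<Sum>\<^sub>\<infinity>s::int. q powi (s * (s + 1) div 2) / (1 + q powi s * x))"

lemma appell_m_minus_one: "appell_m x q (- 1) = lerch q x / jtheta (- 1) q"
proof -
  have "(\<Sum>\<^sub>\<infinity>r::int. (-1) powi r * q powi (r * (r - 1) div 2) * (-1) powi r / (1 - q powi (r - 1) * x * (-1)))
      = (\<Sum>\<^sub>\<infinity>r::int. q powi ((r - 1) * ((r - 1) + 1) div 2) / (1 + q powi (r - 1) * x))"
  proof (rule infsum_cong)
    fix r :: int
    have "(-1) powi r * (-1) powi r = (1::complex)"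
      by (simp flip: power_int_mult_distrib)
    then have "(-1) powi r * c * (-1) powi r = c" for c :: complex
      by (metis mult.commute mult.left_commute mult_1)
    then show "(-1) powi r * q powi (r * (r - 1) div 2) * (-1) powi r / (1 - q powi (r - 1) * x * (-1))
      = q powi ((r - 1) * ((r - 1) + 1) div 2) / (1 + q powi (r - 1) * x)"
      by (simp add: mult.commute)
  qed
  also have "\<dots> = lerch q x"
    unfolding lerch_def
    by (rule infsum_reindex_bij_betw[where g = "\<lambda>r. r - 1"
          and f = "\<lambda>s. q powi (s * (s + 1) div 2) / (1 + q powi s * x)"])
       (rule bij_betwI[where g = "\<lambda>r. r + 1"], auto)
  finally show ?thesis
    by (simp add: appell_m_def)
qed

text \<open>The factor \<open>1 / (1 + q powi s * x)\<close> tends to 1 as \<open>s\<close>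
  increases and to 0 as \<open>s\<close> decreases, so it is bounded and the theta factor dominates.
  A vanishing denominator contributes a quotient 0, so poles in \<open>x\<close> do not disturb
  summability.\<close>

lemma lerch_summable:
  fixes q x :: complex
  assumes q: "norm q < 1" "q \<noteq> 0" and x: "x \<noteq> 0"
  shows "(\<lambda>s::int. q powi (s * (s + 1) div 2) / (1 + q powi s * x)) summable_on UNIV"
proof -
  have q0: "(\<lambda>n. q ^ n) \<longlonglongrightarrow> 0"
    using q by (intro LIMSEQ_power_zero) auto
  have "(\<lambda>n. 1 / (1 + q ^ n * x)) \<longlonglongrightarrow> 1 / (1 + 0 * x)"
    by (intro tendsto_intros q0) auto
  from convergent_imp_Bseq[OF convergentI[OF this]]
  obtain A where A: "\<And>n. norm (1 / (1 + q ^ n * x)) \<le> A"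
    by (auto simp: Bseq_def)
  have "(\<lambda>n. q ^ Suc n / (q ^ Suc n + x)) \<longlonglongrightarrow> 0 / (0 + x)"
    using x by (intro tendsto_intros LIMSEQ_Suc[OF q0]) auto
  from convergent_imp_Bseq[OF convergentI[OF this]]
  obtain B where B: "\<And>n. norm (q ^ Suc n / (q ^ Suc n + x)) \<le> B"
    by (auto simp: Bseq_def)
  have bound: "norm (1 / (1 + q powi s * x)) \<le> max A B" for s
  proof (cases "0 \<le> s")
    case True
    then show ?thesis using A[of "nat s"] by (auto simp: power_int_def)
  next
    case False
    define n where "n = nat (- s - 1)"
    have s: "s = - int (Suc n)" using False by (simp add: n_def)
    have "1 / (1 + q powi s * x) = q ^ Suc n / (q ^ Suc n + x)"
      unfolding s power_int_minus power_int_of_nat using q by (simp add: field_simps)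
    then show ?thesis using B[of n] by simp
  qed
  show ?thesis
  proof (rule abs_summable_summable, rule summable_on_comparison_test)
    show "(\<lambda>s::int. max A B * norm q powi (s * (s + 1) div 2)) summable_on UNIV"
      using q by (intro summable_on_cmult_right summable_on_int_theta) auto
    fix s :: int
    have "norm (q powi (s * (s + 1) div 2) / (1 + q powi s * x)) =
        norm (1 / (1 + q powi s * x)) * norm q powi (s * (s + 1) div 2)"
      by (simp add: norm_divide norm_power_int)
    also have "\<dots> \<le> max A B * norm q powi (s * (s + 1) div 2)"
      using bound[of s] by (intro mult_right_mono) auto
    finally show "norm (q powi (s * (s + 1) div 2) / (1 + q powi s * x)) \<le>
        max A B * norm q powi (s * (s + 1) div 2)" .
  qed auto
qed

text \<open>After reindexing, the sums for \<open>q * x\<close> and \<open>x\<close> share the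
  denominator \<open>1 + q powi s * x\<close>, and the numerators combine to a multiple of it. What
  remains is the theta series.\<close>

lemma lerch_shift:
  assumes q: "norm q < 1" "q \<noteq> 0" and x: "x \<noteq> 0" "\<And>s::int. 1 + q powi s * x \<noteq> 0"
  shows "lerch q (q * x) = jtheta (- 1) q - x * lerch q x"
proof -
  let ?t = "\<lambda>s::int. s * (s + 1) div 2"
  have bij: "bij_betw (\<lambda>r::int. r - 1) UNIV UNIV"
    by (rule bij_betwI[where g = "\<lambda>r. r + 1"]) auto
  have t: "?t s = ?t (s - 1) + s" for s :: int
  proof -
    have "s * (s + 1) = (s - 1) * ((s - 1) + 1) + s * 2" by (simp add: algebra_simps)
    then show ?thesis by simp
  qed
  have sum: "(\<lambda>s. q powi ?t s / (1 + q powi s * y)) summable_on UNIV" if "y \<noteq> 0" for y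
    by (rule lerch_summable[OF q that])
  have eq: "q powi ?t (s - 1) / (1 + q powi (s - 1) * (q * x)) = q powi ?t (s - 1) / (1 + q powi s * x)" for s
    using q by (simp add: power_int_diff)
  have "(\<lambda>s. q powi ?t (s - 1) / (1 + q powi (s - 1) * (q * x))) summable_on UNIV"
    using sum[of "q * x"] q x
    by (subst summable_on_reindex_bij_betw[OF bij, where f = "\<lambda>s. q powi ?t s / (1 + q powi s * (q * x))"]) auto
  then have sum1: "(\<lambda>s. q powi ?t (s - 1) / (1 + q powi s * x)) summable_on UNIV"
    unfolding eq .
  have "lerch q (q * x) = (\<Sum>\<^sub>\<infinity>s. q powi ?t (s - 1) / (1 + q powi (s - 1) * (q * x)))"
    unfolding lerch_def
    by (rule infsum_reindex_bij_betw[OF bij, symmetric, where f = "\<lambda>s. q powi ?t s / (1 + q powi s * (q * x))"])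
  also have "\<dots> = (\<Sum>\<^sub>\<infinity>s. q powi ?t (s - 1) / (1 + q powi s * x))"
    unfolding eq ..
  finally have "lerch q (q * x) + x * lerch q x =
      (\<Sum>\<^sub>\<infinity>s. q powi ?t (s - 1) / (1 + q powi s * x)) + (\<Sum>\<^sub>\<infinity>s. x * (q powi ?t s / (1 + q powi s * x)))"
    unfolding lerch_def by (simp only: infsum_cmult_right[OF sum[OF x(1)]])
  also have "\<dots> = (\<Sum>\<^sub>\<infinity>s. q powi ?t (s - 1) / (1 + q powi s * x) + x * (q powi ?t s / (1 + q powi s * x)))"
    by (rule infsum_add[symmetric, OF sum1 summable_on_cmult_right[OF sum[OF x(1)]]])
  also have "\<dots> = (\<Sum>\<^sub>\<infinity>s. q powi ?t (s - 1))"
  proof (rule infsum_cong)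
    fix s
    have "q powi ?t s = q powi ?t (s - 1) * q powi s"
      using q power_int_add[of q "?t (s - 1)" s] unfolding t[of s] by simp
    then show "q powi ?t (s - 1) / (1 + q powi s * x) + x * (q powi ?t s / (1 + q powi s * x)) = q powi ?t (s - 1)"
      using x(2)[of s] by (simp only:) (simp add: divide_simps, simp add: algebra_simps)
  qed
  also have "\<dots> = (\<Sum>\<^sub>\<infinity>s. q powi ?t s)"
    by (rule infsum_reindex_bij_betw[OF bij, where f = "\<lambda>s. q powi ?t s"])
  also have "\<dots> = jtheta (- 1) q"
    by (rule infsum_int_theta[OF q(1)])
  finally show ?thesis
    by (simp add: algebra_simps)
qed

text \<open>An open neighbourhood of the fundamental domain |q| < |z| <= 1, on which
  \<open>1 + q powi s * z\<close> can vanish only for \<open>s = 0\<close>. The upper bound 1/|q| is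
  written multiplicatively.\<close>

definition annulus :: "complex \<Rightarrow> complex set" where
  "annulus q = {z. norm q < norm z \<and> norm z * norm q < 1}"

lemma open_annulus: "open (annulus q)"
  unfolding annulus_def by (intro open_Collect_conj open_Collect_less continuous_intros)

lemma annulus_nonzero: "z \<in> annulus q \<Longrightarrow> z \<noteq> 0"
  unfolding annulus_def by auto

text \<open>For \<open>s > 0\<close> the product \<open>q powi s * x\<close> has modulus at most
  \<open>M * norm q\<close>, below 1; for \<open>s < 0\<close> at least \<open>m / norm q\<close>,
  above 1. The bound is uniform in \<open>s\<close>, which lets the M-test run over all
  \<open>s\<close> at once.\<close>

lemma norm_one_plus_powi_ge:
  fixes q x :: complex and s :: int
  assumes q: "norm q < 1" "q \<noteq> 0" and s: "s \<noteq> 0"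
    and x: "m \<le> norm x" "norm x \<le> M" and mM: "norm q < m" "M * norm q < 1"
  shows "min (1 - M * norm q) (m / norm q - 1) \<le> norm (1 + q powi s * x)"
proof (cases "0 < s")
  case True
  define n where "n = nat s - 1"
  have s: "s = int (Suc n)" using True by (simp add: n_def)
  have "norm (q powi s) \<le> norm q"
    unfolding s power_int_of_nat using q
    by (simp add: norm_mult norm_power mult_left_le power_le_one)
  then have "norm (q powi s * x) \<le> norm q * M"
    using x by (auto simp: norm_mult intro: mult_mono)
  moreover have "1 - norm (q powi s * x) \<le> norm (1 + q powi s * x)"
    using norm_diff_ineq[of 1 "q powi s * x"] by simp
  ultimately show ?thesis by (auto simp: mult.commute)
next
  case False
  define n where "n = nat (- s) - 1"
  have s: "s = - int (Suc n)" using False s by (simp add: n_def)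
  have "norm q ^ Suc n \<le> norm q"
    using q by (simp add: mult_left_le power_le_one)
  then have "m / norm q \<le> m / norm q ^ Suc n"
    using q mM norm_ge_zero[of q] by (intro divide_left_mono) (auto simp del: norm_ge_zero)
  also have "\<dots> \<le> norm (q powi s * x)"
    unfolding s power_int_minus power_int_of_nat norm_mult norm_inverse norm_power divide_inverse
    using x by (subst mult.commute) (auto intro: mult_left_mono)
  finally have "m / norm q \<le> norm (q powi s * x)" .
  moreover have "norm (q powi s * x) - 1 \<le> norm (1 + q powi s * x)"
    using norm_diff_ineq[of "q powi s * x" 1] by (simp add: add.commute)
  ultimately show ?thesis by auto
qed

lemma lerch_regular_part:
  assumes q: "norm q < 1" "q \<noteq> 0"
  obtains g where "g holomorphic_on annulus q"
    "\<And>x. x \<noteq> 0 \<Longrightarrow> lerch q x = 1 / (1 + x) + g x"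
proof
  let ?f = "\<lambda>s::int. \<lambda>x. q powi (s * (s + 1) div 2) / (1 + q powi s * x)"
  let ?g = "\<lambda>x. \<Sum>\<^sub>\<infinity>s\<in>-{0}. ?f s x"
  show "lerch q x = 1 / (1 + x) + ?g x" if "x \<noteq> 0" for x
  proof -
    have sum: "(\<lambda>s. ?f s x) summable_on UNIV" by (rule lerch_summable[OF q that])
    have "lerch q x = (\<Sum>\<^sub>\<infinity>s\<in>{0} \<union> -{0}. ?f s x)"
      by (simp add: lerch_def)
    also have "\<dots> = (\<Sum>\<^sub>\<infinity>s\<in>{0}. ?f s x) + ?g x"
      by (intro infsum_Un_disjoint summable_on_subset_banach[OF sum]) auto
    finally show ?thesis by simp
  qed
  show "?g holomorphic_on annulus q"
    unfolding holomorphic_on_def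
  proof
    fix x0 assume x0: "x0 \<in> annulus q"
    \<comment> \<open>Half the distance to the boundary of the annulus, so that the closed disc
      keeps a positive margin.\<close>
    define r where "r = min (norm x0 - norm q) (1 / norm q - norm x0) / 2"
    define m where "m = norm x0 - r"
    define M where "M = norm x0 + r"
    have nq: "0 < norm q" using q by simp
    have "norm x0 < 1 / norm q" "norm q < norm x0"
      using x0 nq by (auto simp: annulus_def field_simps)
    then have r: "0 < r" "norm q < m" "M < 1 / norm q"
      unfolding r_def m_def M_def by (auto simp: min_def field_simps)
    have mM: "norm q < m" "M * norm q < 1"
      using r nq by (auto simp: field_simps)
    have x: "m \<le> norm x \<and> norm x \<le> M" if "x \<in> cball x0 r" for x
    proof -
      have "norm (x0 - x) \<le> r" using that by (simp add: dist_norm)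
      then show ?thesis
        using norm_triangle_ineq2[of x0 x] norm_triangle_ineq2[of x x0] norm_minus_commute[of x x0]
        by (auto simp: m_def M_def)
    qed
    define d where "d = min (1 - M * norm q) (m / norm q - 1)"
    have d: "0 < d" using mM nq by (auto simp: d_def field_simps)
    have lb: "d \<le> norm (1 + q powi s * x)" if "x \<in> cball x0 r" "s \<noteq> 0" for s :: int and x
      unfolding d_def using norm_one_plus_powi_ge[OF q that(2) _ _ mM] x[OF that(1)] by blast
    have lim: "uniform_limit (cball x0 r) (\<lambda>S x. \<Sum>s\<in>S. ?f s x) ?g (finite_subsets_at_top (-{0}))"
    proof (rule Weierstrass_m_test_general)
      show "(\<lambda>s::int. norm q powi (s * (s + 1) div 2) * (1 / d)) summable_on -{0}"
        using q by (intro summable_on_cmult_left summable_on_subset_banach[OF summable_on_int_theta]) auto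
      fix s :: int and x assume s: "s \<in> -{0}" and "x \<in> cball x0 r"
      then have "1 / norm (1 + q powi s * x) \<le> 1 / d"
        using lb[of x s] d by (intro divide_left_mono) (auto intro: mult_pos_pos order_less_le_trans)
      then show "norm (?f s x) \<le> norm q powi (s * (s + 1) div 2) * (1 / d)"
        unfolding norm_divide norm_power_int
        by (subst divide_inverse, unfold inverse_eq_divide) (intro mult_left_mono, auto)
    qed
    have "eventually (\<lambda>S. continuous_on (cball x0 r) (\<lambda>x. \<Sum>s\<in>S. ?f s x) \<and>
        (\<lambda>x. \<Sum>s\<in>S. ?f s x) holomorphic_on ball x0 r) (finite_subsets_at_top (-{0}))"
    proof (rule eventually_finite_subsets_at_top_weakI)
      fix S :: "int set" assume S: "finite S" "S \<subseteq> -{0}"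
      have ne: "1 + q powi s * x \<noteq> 0" if "x \<in> cball x0 r" "s \<in> S" for s x
      proof -
        have "s \<noteq> 0" using that(2) S by auto
        from lb[OF that(1) this] d show ?thesis by auto
      qed
      have "(\<lambda>x. \<Sum>s\<in>S. ?f s x) holomorphic_on cball x0 r"
        using ne by (intro holomorphic_intros) auto
      then show "continuous_on (cball x0 r) (\<lambda>x. \<Sum>s\<in>S. ?f s x) \<and>
          (\<lambda>x. \<Sum>s\<in>S. ?f s x) holomorphic_on ball x0 r"
        using holomorphic_on_imp_continuous_on holomorphic_on_subset ball_subset_cball by blast
    qed
    from holomorphic_uniform_limit[OF this lim] have "?g holomorphic_on ball x0 r"
      by auto
    then have "?g field_differentiable at x0"
      by (rule holomorphic_on_imp_differentiable_at) (use r(1) in auto)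
    then show "?g field_differentiable at x0 within annulus q"
      by (rule field_differentiable_at_within)
  qed
qed

section \<open>The mock theta series\<close>

definition mock :: "complex \<Rightarrow> complex \<Rightarrow> complex" where
  "mock q a = (1 + 1 / a) *
     (\<Sum>n. qpoch (- a * q) q n * qpoch (- q / a) q n * q ^ (n + 1) / qpoch q (q\<^sup>2) (n + 1))"

lemma qpoch_q_q2_bound:
  assumes q: "norm q < 1"
  obtains B where "\<And>n. norm (1 / qpoch q (q\<^sup>2) n) \<le> B"
proof -
  have "(\<lambda>n. 1 / qpoch q (q\<^sup>2) n) \<longlonglongrightarrow> 1 / qpoch_inf q (q\<^sup>2)"
    using q Jprod_nonzero[OF q]
    by (intro tendsto_intros qpoch_tendsto) (auto simp: norm_power_less_one qpoch_inf_q_q2)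
  from convergent_imp_Bseq[OF convergentI[OF this]] show ?thesis
    using that by (auto simp: Bseq_def)
qed

text \<open>One constant serves all \<open>a\<close> with |a| and |1/a| at most \<open>r\<close>,
  which yields uniform convergence on compact subsets of the punctured plane. The denominators are
  harmless because they tend to a nonzero limit.\<close>

lemma mock_terms_bound:
  assumes q: "norm q < 1"
  obtains C where "\<And>a n. norm a \<le> r \<Longrightarrow> norm (1 / a) \<le> r \<Longrightarrow>
    norm (qpoch (- a * q) q n * qpoch (- q / a) q n * q ^ (n + 1) / qpoch q (q\<^sup>2) (n + 1)) \<le> C * norm q ^ n"
proof -
  obtain B where B: "\<And>n. norm (1 / qpoch q (q\<^sup>2) n) \<le> B"
    using qpoch_q_q2_bound[OF q] by blast
  define E where "E = exp (r / (1 - norm q))"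
  have "norm (qpoch (- a * q) q n * qpoch (- q / a) q n * q ^ (n + 1) / qpoch q (q\<^sup>2) (n + 1))
      \<le> (E * E * B) * norm q ^ n" if a: "norm a \<le> r" "norm (1 / a) \<le> r" for a n
  proof -
    have "norm (- a * q) \<le> r" "norm (- q / a) \<le> r"
      using a q mult_left_le[of "norm q" "norm a"] mult_left_le[of "norm q" "norm (1 / a)"]
      by (auto simp: norm_mult norm_divide)
    then have E: "norm (qpoch (- a * q) q n) \<le> E" "norm (qpoch (- q / a) q n) \<le> E"
      unfolding E_def using norm_qpoch_le[OF q] by blast+
    have qn: "norm (q ^ (n + 1)) \<le> norm q ^ n"
      using q by (simp add: norm_mult norm_power mult_right_le_one_le mult_left_le_one_le)
    have "norm (qpoch (- a * q) q n * qpoch (- q / a) q n * q ^ (n + 1) / qpoch q (q\<^sup>2) (n + 1)) =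
        norm (qpoch (- a * q) q n) * norm (qpoch (- q / a) q n) *
        norm (1 / qpoch q (q\<^sup>2) (n + 1)) * norm (q ^ (n + 1))"
      by (simp add: norm_mult norm_divide)
    also have "\<dots> \<le> E * E * B * norm q ^ n"
      using E B[of "n + 1"] qn order_trans[OF norm_ge_zero B]
      by (intro mult_mono mult_nonneg_nonneg) (auto simp: E_def)
    finally show ?thesis .
  qed
  then show ?thesis using that by blast
qed

lemma mock_summable:
  assumes q: "norm q < 1"
  shows "summable (\<lambda>n. qpoch (- a * q) q n * qpoch (- q / a) q n * q ^ (n + 1) / qpoch q (q\<^sup>2) (n + 1))"
proof -
  obtain C where C: "\<And>b n. norm b \<le> max (norm a) (norm (1 / a)) \<Longrightarrow> norm (1 / b) \<le> max (norm a) (norm (1 / a)) \<Longrightarrow>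
    norm (qpoch (- b * q) q n * qpoch (- q / b) q n * q ^ (n + 1) / qpoch q (q\<^sup>2) (n + 1)) \<le> C * norm q ^ n"
    using mock_terms_bound[OF q] by blast
  show ?thesis
  proof (rule summable_comparison_test')
    show "summable (\<lambda>n. C * norm q ^ n)"
      using q by (intro summable_mult summable_geometric) auto
  qed (rule C, auto)
qed

lemma holomorphic_mock:
  assumes q: "norm q < 1"
  shows "mock q holomorphic_on - {0}"
proof -
  let ?f = "\<lambda>n a. qpoch (- a * q) q n * qpoch (- q / a) q n * q ^ (n + 1) / qpoch q (q\<^sup>2) (n + 1)"
  have "(\<lambda>a. \<Sum>n. ?f n a) holomorphic_on - {0}"
  proof (rule holomorphic_uniform_sequence[where f = "\<lambda>N a. \<Sum>n<N. ?f n a"])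
    show "(\<lambda>a. \<Sum>n<N. ?f n a) holomorphic_on - {0}" for N
      unfolding qpoch_def[of "_ * q"] qpoch_def[of "_ / _"]
      using qpoch_q_q2_nonzero[OF q] by (intro holomorphic_intros) auto
    fix x :: complex assume x: "x \<in> - {0}"
    define r where "r = norm x / 2"
    define R where "R = max (3 * r) (1 / r)"
    have r: "0 < r" using x by (simp add: r_def)
    have "r \<le> norm y \<and> norm y \<le> 3 * r" if "y \<in> cball x r" for y
    proof -
      have "norm (x - y) \<le> r" using that by (simp add: dist_norm)
      then show ?thesis
        using norm_triangle_ineq2[of x y] norm_triangle_ineq2[of y x] norm_minus_commute[of x y]
        by (auto simp: r_def)
    qed
    then have y: "y \<noteq> 0 \<and> norm y \<le> R \<and> norm (1 / y) \<le> R" if "y \<in> cball x r" for y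
      using r that frac_le[of 1 1 r "norm y"] by (force simp: R_def norm_divide le_max_iff_disj)
    obtain C where C: "\<And>a n. norm a \<le> R \<Longrightarrow> norm (1 / a) \<le> R \<Longrightarrow> norm (?f n a) \<le> C * norm q ^ n"
      using mock_terms_bound[OF q] by blast
    have "uniform_limit (cball x r) (\<lambda>N a. \<Sum>n<N. ?f n a) (\<lambda>a. \<Sum>n. ?f n a) sequentially"
    proof (rule Weierstrass_m_test)
      show "summable (\<lambda>n. C * norm q ^ n)"
        using q by (intro summable_mult summable_geometric) auto
    qed (use C y in blast)
    then show "\<exists>d>0. cball x d \<subseteq> - {0} \<and>
        uniform_limit (cball x d) (\<lambda>N a. \<Sum>n<N. ?f n a) (\<lambda>a. \<Sum>n. ?f n a) sequentially"
      using r y by (intro exI[of _ r]) blast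
  qed auto
  then show ?thesis
    unfolding mock_def[abs_def] by (intro holomorphic_intros) auto
qed

text \<open>Weighted by their prefactors, the n-th terms at \<open>a\<close> and
  \<open>q * a\<close> add up to \<open>V (Suc n) - V n\<close>. The limit of \<open>V\<close> gives
  the theta quotient and \<open>V 0 = 1\<close> gives the -1.\<close>

lemma mock_shift:
  assumes q: "norm q < 1" "q \<noteq> 0" and a: "a \<noteq> 0"
  shows "mock q (q * a) = - 1 + jtheta (- a) q / (a * jtheta q (q\<^sup>2)) - a * mock q a"
proof -
  let ?T = "\<lambda>n a. qpoch (- a * q) q n * qpoch (- q / a) q n * q ^ (n + 1) / qpoch q (q\<^sup>2) (n + 1)"
  define V where "V n = qpoch (- a * q) q n * qpoch (- 1 / a) q n / qpoch q (q\<^sup>2) n" for n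
  have step: "(1 + a) * ?T n a + (1 + 1 / (q * a)) * ?T n (q * a) = V (Suc n) - V n" for n
  proof -
    define X Y D Q where "X = qpoch (- a * q) q n" and "Y = qpoch (- 1 / a) q n"
      and "D = qpoch q (q\<^sup>2) n" and "Q = q ^ n"
    have Q2: "(q\<^sup>2) ^ n = Q * Q" by (simp add: Q_def power2_eq_square power_mult_distrib)
    have D: "D \<noteq> 0" "1 - q * (Q * Q) \<noteq> 0"
      using qpoch_q_q2_nonzero[OF q(1), of n] qpoch_q_q2_nonzero[OF q(1), of "Suc n"]
      by (auto simp: D_def qpoch_Suc Q2)
    \<comment> \<open>The prefactor supplies the missing first factor: both sides are the product
      (-1/a;q) of length n + 1, split off at its first and at its last factor. The same device
      treats the other product below.\<close>
    have "(1 + 1 / a) * qpoch (- q / a) q n = Y * (1 + Q / a)"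
      using qpoch_Suc_shift[of "- 1 / a" q n] qpoch_Suc[of "- 1 / a" q n] by (simp add: Y_def Q_def)
    then have 1: "(1 + a) * qpoch (- q / a) q n = a * (Y * (1 + Q / a))"
      using a by (simp add: field_simps)
    have "(1 + a * q) * qpoch (- (q * a) * q) q n = X * (1 + a * q * Q)"
      using qpoch_Suc_shift[of "- a * q" q n] qpoch_Suc[of "- a * q" q n] by (simp add: X_def Q_def ac_simps)
    then have 2: "(1 + 1 / (q * a)) * qpoch (- (q * a) * q) q n = X * (1 + a * q * Q) / (q * a)"
      using a q by (simp add: field_simps)
    have 3: "- q / (q * a) = - 1 / a" using q by simp
    have "(1 + a) * ?T n a + (1 + 1 / (q * a)) * ?T n (q * a) =
        (X * ((1 + a) * qpoch (- q / a) q n) + ((1 + 1 / (q * a)) * qpoch (- (q * a) * q) q n) * Y)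
        * (q * Q) / (D * (1 - q * (Q * Q)))"
      unfolding 3 by (simp add: X_def Y_def D_def Q_def[symmetric] qpoch_Suc Q2 add_divide_distrib algebra_simps)
    also have "\<dots> = X * Y * (a * q * Q + Q / a + 2 * (q * (Q * Q))) / (D * (1 - q * (Q * Q)))"
      unfolding 1 2 using a q by (intro arg_cong2[where f = "(/)"] refl) (simp add: field_simps)
    \<comment> \<open>The bracket is arranged as the numerator minus the denominator of
      \<open>V (Suc n) / V n\<close>.\<close>
    also have "\<dots> = X * Y * ((1 + a * q * Q) * (1 + Q / a) - (1 - q * (Q * Q))) / (D * (1 - q * (Q * Q)))"
      using a by (intro arg_cong2[where f = "(/)"] arg_cong2[where f = "(*)"] refl) (simp add: field_simps)
    also have "\<dots> = X * (1 + a * q * Q) * (Y * (1 + Q / a)) / (D * (1 - q * (Q * Q))) - X * Y / D"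
    proof -
      have "X * Y * (u - v) / (D * v) = X * Y * u / (D * v) - X * Y / D" if "v \<noteq> 0" for u v
        using that D(1) by (simp add: field_simps)
      from this[OF D(2)] show ?thesis by (simp add: ac_simps)
    qed
    also have "\<dots> = V (Suc n) - V n"
      by (simp add: V_def X_def Y_def D_def Q_def[symmetric] qpoch_Suc Q2 ac_simps)
    finally show ?thesis .
  qed
  have s1: "(\<lambda>n. ?T n b) sums (\<Sum>n. ?T n b)" for b
    by (rule summable_sums[OF mock_summable[OF q(1)]])
  have "(\<lambda>n. V (Suc n) - V n) sums ((1 + a) * (\<Sum>n. ?T n a) + (1 + 1 / (q * a)) * (\<Sum>n. ?T n (q * a)))"
    unfolding step[symmetric] by (intro sums_add sums_mult s1)
  moreover have "(1 + a) * (\<Sum>n. ?T n a) + (1 + 1 / (q * a)) * (\<Sum>n. ?T n (q * a)) = a * mock q a + mock q (q * a)"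
  proof -
    have "a * (1 + 1 / a) = 1 + a" using a by (simp add: field_simps)
    then show ?thesis
      unfolding mock_def by (simp only: mult.assoc[symmetric])
  qed
  ultimately have sum: "(\<lambda>n. V (Suc n) - V n) sums (a * mock q a + mock q (q * a))"
    by (simp only:)
  have "V \<longlonglongrightarrow> qpoch_inf (- a * q) q * qpoch_inf (- 1 / a) q / qpoch_inf q (q\<^sup>2)"
    unfolding V_def using q Jprod_nonzero[OF q(1)]
    by (intro tendsto_intros qpoch_tendsto) (auto simp: norm_power_less_one qpoch_inf_q_q2)
  also have "qpoch_inf (- a * q) q * qpoch_inf (- 1 / a) q / qpoch_inf q (q\<^sup>2) = jtheta (- a) q / (a * jtheta q (q\<^sup>2))"
  proof -
    have "qpoch_inf (- a) q = (1 + a) * qpoch_inf (- a * q) q"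
      using qpoch_inf_shift[OF q(1), of "- a"] by simp
    moreover have "qpoch_inf (- 1 / a) q = (1 + 1 / a) * qpoch_inf (- q / a) q"
      using qpoch_inf_shift[OF q(1), of "- 1 / a"] by simp
    moreover have "q / - a = - q / a" by simp
    moreover have "qpoch_inf q q = Jprod 1 q" by (simp add: Jprod_def)
    ultimately show ?thesis
      unfolding jtheta_q_q2[OF q] qpoch_inf_q_q2[OF q(1)] unfolding jtheta_def
      using a Jprod_nonzero[OF q(1), of 1] Jprod_nonzero[OF q(1), of 2]
      by (simp only:) (simp add: field_simps power2_eq_square)
  qed
  finally have "(\<lambda>n. V (Suc n) - V n) sums (jtheta (- a) q / (a * jtheta q (q\<^sup>2)) - V 0)"
    by (rule telescope_sums)
  then have "a * mock q a + mock q (q * a) = jtheta (- a) q / (a * jtheta q (q\<^sup>2)) - V 0"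
    using sum sums_unique2 by blast
  then show ?thesis
    by (simp add: V_def algebra_simps)
qed

section \<open>Uniqueness for the functional equation\<close>

lemma fundamental_annulus:
  fixes q z :: complex
  assumes q: "norm q < 1" "q \<noteq> 0" and z: "z \<noteq> 0" "norm z \<le> 1"
  obtains n u where "z = q ^ n * u" "norm q < norm u" "norm u \<le> 1"
proof -
  define n where "n = (LEAST n. norm q ^ Suc n < norm z)"
  have "\<exists>n. norm q ^ n < norm z"
    using q z by (intro real_arch_pow_inv) auto
  then have "\<exists>n. norm q ^ Suc n < norm z"
    using z(2) by (metis old.nat.exhaust power_0 linorder_not_less)
  then have n: "norm q ^ Suc n < norm z"
    unfolding n_def by (rule LeastI_ex)
  have "norm z \<le> norm q ^ n"
  proof (cases n)
    case (Suc m)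
    then have "\<not> norm q ^ Suc m < norm z"
      unfolding n_def by (metis lessI not_less_Least)
    then show ?thesis using Suc by simp
  qed (use z in simp)
  moreover have "0 < norm q ^ n" using q by simp
  ultimately have "norm q < norm (z / q ^ n)" "norm (z / q ^ n) \<le> 1"
    using n by (auto simp: norm_divide norm_power field_simps)
  moreover have "z = q ^ n * (z / q ^ n)" using q by simp
  ultimately show ?thesis using that by blast
qed

text \<open>Coefficientwise the functional equation reads \<open>c\<^sub>n q\<^sup>n = - c\<^sub>n\<^sub>-\<^sub>1\<close>, which leaves no
  room for a lowest nonzero coefficient.\<close>

lemma q_difference_zero_disc:
  assumes q: "norm q < 1" "q \<noteq> 0"
    and hol: "H holomorphic_on ball 0 1 - {0}"
    and bdd: "\<And>z. z \<noteq> 0 \<Longrightarrow> norm z < 1 \<Longrightarrow> norm (H z) \<le> M"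
    and shift: "\<And>z. z \<noteq> 0 \<Longrightarrow> norm z < 1 \<Longrightarrow> H (q * z) = - z * H z"
    and z: "z \<noteq> 0" "norm z < 1"
  shows "H z = 0"
proof -
  have small: "norm (q * w) < 1" if "norm w < 1" for w
    using q that mult_strict_mono[of "norm q" 1 "norm w" 1] by (simp add: norm_mult)
  have "eventually (\<lambda>w. norm (H w) \<le> M) (at 0)"
    using bdd by (auto simp: eventually_at intro!: exI[of _ 1])
  then have "\<exists>G. G holomorphic_on ball 0 1 \<and> (\<forall>w\<in>ball 0 1 - {0}. G w = H w)"
    by (subst holomorphic_on_extend_bounded[OF hol]) auto
  then obtain G where G: "G holomorphic_on ball 0 1" and GH: "\<And>w. w \<noteq> 0 \<Longrightarrow> norm w < 1 \<Longrightarrow> G w = H w"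
    by (auto simp: dist_norm)
  have cont: "G \<midarrow>0\<rightarrow> G 0"
    using G by (metis centre_in_ball continuous_on_eq_continuous_at holomorphic_on_imp_continuous_on isContD open_ball zero_less_one)
  have lim_q: "filterlim (\<lambda>w. q * w) (at 0) (at 0)"
    using q by (intro filterlim_atI tendsto_eq_intros) (auto simp: eventually_at intro!: exI[of _ 1])
  have shiftG: "eventually (\<lambda>w. G (q * w) = - w * G w) (at 0)"
    using q small shift GH by (auto simp: eventually_at intro!: exI[of _ 1])
  have "(\<lambda>w. - w * G w) \<midarrow>0\<rightarrow> - 0 * G 0"
    by (intro tendsto_intros cont)
  then have "(\<lambda>w. G (q * w)) \<midarrow>0\<rightarrow> - 0 * G 0"
    by (rule Lim_transform_eventually) (use shiftG in \<open>auto elim: eventually_mono\<close>)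
  with filterlim_compose[OF cont lim_q] have "G 0 = - 0 * G 0"
    using LIM_unique by blast
  then have G0: "G 0 = 0"
    by simp
  have "G constant_on ball 0 1"
  proof (rule ccontr)
    assume nc: "\<not> G constant_on ball 0 1"
    have 0: "(0::complex) \<in> ball 0 1" by simp
    obtain g r n where r: "0 < r" and g: "g holomorphic_on ball 0 r"
        "\<And>w. w \<in> ball 0 r \<Longrightarrow> G w = (w - 0) ^ n * g w"
        "\<And>w. w \<in> ball 0 r \<Longrightarrow> g w \<noteq> 0"
      by (rule holomorphic_factor_zero_nonconstant[OF G open_ball connected_ball 0 G0 nc]) (rule that)
    have cont_g: "g \<midarrow>0\<rightarrow> g 0"
      using g(1) r(1) by (metis centre_in_ball continuous_on_eq_continuous_at holomorphic_on_imp_continuous_on isContD open_ball)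
    have ev: "eventually (\<lambda>w. w \<in> ball 0 r - {0}) (at 0)"
      using r by (auto simp: eventually_at dist_commute intro!: exI[of _ r])
    \<comment> \<open>Cancelling \<open>w ^ n\<close> leaves an extra factor \<open>w\<close> on one
      side only, so the limit at 0 forces \<open>q ^ n * g 0 = 0\<close>.\<close>
    have "eventually (\<lambda>w. - w * g w = q ^ n * g (q * w)) (at 0)"
      using shiftG ev
    proof eventually_elim
      case (elim w)
      have "norm (q * w) \<le> norm w"
        using q by (simp add: norm_mult mult_left_le_one_le)
      then have "q * w \<in> ball 0 r" using elim by auto
      then have "(q * w) ^ n * g (q * w) = - w * (w ^ n * g w)"
        using elim g(2)[of w] g(2)[of "q * w"] by simp
      then have "w ^ n * (q ^ n * g (q * w)) = w ^ n * (- w * g w)"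
        by (simp add: power_mult_distrib ac_simps)
      moreover have "w ^ n \<noteq> 0" using elim by simp
      ultimately show ?case by (metis mult_left_cancel)
    qed
    moreover have "(\<lambda>w. - w * g w) \<midarrow>0\<rightarrow> - 0 * g 0"
      by (intro tendsto_intros cont_g)
    ultimately have "(\<lambda>w. q ^ n * g (q * w)) \<midarrow>0\<rightarrow> - 0 * g 0"
      by (rule Lim_transform_eventually[rotated])
    moreover have "(\<lambda>w. q ^ n * g (q * w)) \<midarrow>0\<rightarrow> q ^ n * g 0"
      by (intro tendsto_intros filterlim_compose[OF cont_g lim_q])
    ultimately have "q ^ n * g 0 = - 0 * g 0"
      using LIM_unique by blast
    then show False
      using q g(3)[of 0] r by simp
  qed
  then have "G z = G 0"
    using z by (auto simp: constant_on_def)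
  then show ?thesis
    using GH[OF z] G0 by simp
qed

text \<open>The predicate \<open>good\<close> separates the points where \<open>D\<close> has its
  intended value from the exceptional ones. A continuation known on the annulus is transported
  inwards by the functional equation, which reaches every punctured neighbourhood of 0; there the
  disc version applies.\<close>

lemma q_difference_zero:
  assumes q: "norm q < 1" "q \<noteq> 0"
    and good_shift: "\<And>z. z \<noteq> 0 \<Longrightarrow> good (q * z) \<longleftrightarrow> good z"
    and shift: "\<And>z. z \<noteq> 0 \<Longrightarrow> good z \<Longrightarrow> D (q * z) = - z * D z"
    and g: "g holomorphic_on annulus q"
    and good: "\<And>z. z \<in> annulus q \<Longrightarrow> \<forall>\<^sub>F w in at z. good w"
    and eq: "\<And>z. z \<in> annulus q \<Longrightarrow> good z \<Longrightarrow> D z = g z"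
    and a: "a \<noteq> 0" "good a"
  shows "D a = 0"
proof -
  \<comment> \<open>\<open>h\<close> continues \<open>D\<close> analytically to \<open>z\<close>; the value of \<open>D\<close> at a point that is not good is junk.\<close>
  define ext where "ext h z \<longleftrightarrow> h analytic_on {z} \<and> (\<forall>\<^sub>F w in at z. good w) \<and>
    (\<forall>\<^sub>F w in nhds z. good w \<longrightarrow> D w = h w)" for h z
  have ext_ex: "\<exists>h. ext h (q ^ n * z)" if "z \<in> annulus q" for n z
  proof (induction n)
    case 0
    have "eventually (\<lambda>w. w \<in> annulus q) (nhds z)"
      using that open_annulus by (simp add: eventually_nhds_in_open)
    then have "ext g z"
      unfolding ext_def using g that good eq open_annulus
      by (auto simp: analytic_at intro: eventually_mono)
    then show ?case by auto
  next
    case (Suc n)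
    then obtain h where h: "ext h (q ^ n * z)" by blast
    define y where "y = q ^ n * z"
    have y: "y \<noteq> 0" using q annulus_nonzero[OF that] by (simp add: y_def)
    have lim: "((\<lambda>w. w / q) \<longlongrightarrow> y) (nhds (q * y))"
      using q by (auto intro!: tendsto_eq_intros filterlim_ident)
    have lim': "filterlim (\<lambda>w. w / q) (at y) (at (q * y))"
    proof (rule filterlim_atI)
      show "((\<lambda>w. w / q) \<longlongrightarrow> y) (at (q * y))"
        using q by (auto intro!: tendsto_eq_intros)
      show "\<forall>\<^sub>F w in at (q * y). w / q \<noteq> y"
        using q by (auto simp: eventually_at field_simps intro!: exI[of _ 1])
    qed
    have nz: "\<forall>\<^sub>F w in nhds (q * y). w \<noteq> 0"
      using q y by (intro t1_space_nhds) auto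
    have nz': "\<forall>\<^sub>F w in at (q * y). w \<noteq> 0"
      using nz by (simp add: eventually_nhds_conv_at)
    \<comment> \<open>The functional equation read backwards: values near \<open>q * y\<close> are
      determined by values near \<open>y\<close>.\<close>
    have "ext (\<lambda>w. - (w / q) * h (w / q)) (q * y)"
      unfolding ext_def
    proof safe
      have "h analytic_on (\<lambda>w. w / q) ` {q * y}"
        using h q by (simp add: ext_def y_def)
      then have "(h \<circ> (\<lambda>w. w / q)) analytic_on {q * y}"
        using q by (intro analytic_on_compose analytic_intros) auto
      then show "(\<lambda>w. - (w / q) * h (w / q)) analytic_on {q * y}"
        using q by (intro analytic_intros) (auto simp: o_def)
      have "\<forall>\<^sub>F w in at (q * y). good (w / q)"
        using h lim' by (auto simp: ext_def y_def filterlim_iff)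
      with nz' show "\<forall>\<^sub>F w in at (q * y). good w"
      proof eventually_elim
        case (elim w)
        then show ?case using good_shift[of "w / q"] q by simp
      qed
      have "\<forall>\<^sub>F w in nhds (q * y). good (w / q) \<longrightarrow> D (w / q) = h (w / q)"
        using h lim by (auto simp: ext_def y_def filterlim_iff)
      with nz show "\<forall>\<^sub>F w in nhds (q * y). good w \<longrightarrow> D w = - (w / q) * h (w / q)"
      proof eventually_elim
        case (elim w)
        then show ?case using good_shift[of "w / q"] shift[of "w / q"] q by simp
      qed
    qed
    then show ?case by (auto simp: y_def mult.assoc)
  qed
  have near: "norm z * norm q < 1" if "norm z \<le> 1" for z :: complex
    using q that mult_right_mono[of "norm z" 1 "norm q"] norm_ge_zero[of q] by linarith
  have ext1: "\<exists>h. ext h z" if z: "z \<noteq> 0" "norm z * norm q < 1" for z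
  proof (cases "norm z \<le> 1")
    case True
    obtain n u where u: "z = q ^ n * u" "norm q < norm u" "norm u \<le> 1"
      using fundamental_annulus[OF q z(1) True] .
    with near[OF u(3)] show ?thesis using ext_ex[of u n] by (simp add: annulus_def)
  next
    case False
    then show ?thesis using ext_ex[of z 0] z q by (simp add: annulus_def)
  qed
  \<comment> \<open>A limit of \<open>D\<close> does not depend on the choice of local continuation,
    so the local pieces glue automatically.\<close>
  define H where "H z = Lim (at z) D" for z
  have ext_lim: "(D \<longlongrightarrow> h z) (at z)" if "ext h z" for h z
  proof -
    have "h \<midarrow>z\<rightarrow> h z"
      using that analytic_at_imp_isCont by (auto simp: ext_def isCont_def)
    moreover have "\<forall>\<^sub>F w in at z. h w = D w"
      using that unfolding ext_def eventually_nhds_conv_at by (auto elim: eventually_elim2)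
    ultimately show ?thesis
      by (rule Lim_transform_eventually)
  qed
  have HI: "H z = h z" if "ext h z" for h z
    unfolding H_def using ext_lim[OF that] by (intro tendsto_Lim) auto
  have limH: "(D \<longlongrightarrow> H z) (at z)" if "z \<noteq> 0" "norm z * norm q < 1" for z
    using ext1[OF that] ext_lim HI by metis
  have analytic: "H analytic_on {z}" if z: "z \<noteq> 0" "norm z * norm q < 1" for z
  proof -
    obtain h where h: "ext h z" using ext1[OF z] by blast
    then obtain S where S: "open S" "z \<in> S" "h holomorphic_on S"
      by (auto simp: ext_def analytic_at)
    then have "\<forall>\<^sub>F w in nhds z. h analytic_on {w}"
      using eventually_nhds_in_open[of S z] by (auto simp: analytic_at elim: eventually_mono)
    moreover have "\<forall>\<^sub>F w in nhds z. \<forall>\<^sub>F v in nhds w. good v \<longrightarrow> D v = h v"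
      using h by (simp add: ext_def eventually_eventually)
    moreover have "open {w. w \<noteq> 0 \<and> norm w * norm q < 1}"
      by (intro open_Collect_conj open_Collect_less open_Collect_neq continuous_intros)
    then have "\<forall>\<^sub>F w in nhds z. w \<noteq> 0 \<and> norm w * norm q < 1"
      using z eventually_nhds_in_open[of "{w. w \<noteq> 0 \<and> norm w * norm q < 1}" z] by simp
    \<comment> \<open>The single continuation \<open>h\<close> also serves every centre near
      \<open>z\<close>, so \<open>H\<close> agrees with it on a whole neighbourhood and inherits
      analyticity.\<close>
    ultimately have "\<forall>\<^sub>F w in nhds z. H w = h w"
    proof eventually_elim
      case (elim w)
      obtain h' where "ext h' w" using ext1 elim by blast
      then have "\<forall>\<^sub>F v in at w. good v" by (simp add: ext_def)
      then have "ext h w" using elim by (simp add: ext_def)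
      then show ?case by (rule HI)
    qed
    then show ?thesis
      using h analytic_at_cong[of H h z z] by (simp add: ext_def)
  qed
  have shiftH: "H (q * z) = - z * H z" if z: "z \<noteq> 0" "norm z * norm q < 1" for z
  proof -
    have "norm z * norm q * norm q < 1 * 1"
      using z q by (intro mult_strict_mono) auto
    then have qz: "norm (q * z) * norm q < 1" by (simp add: norm_mult ac_simps)
    have "filterlim (\<lambda>w. q * w) (at (q * z)) (at z)"
      using q by (intro filterlim_atI tendsto_eq_intros) (auto simp: eventually_at intro!: exI[of _ 1])
    moreover have "q * z \<noteq> 0" using q z by simp
    ultimately have "((\<lambda>w. D (q * w)) \<longlongrightarrow> H (q * z)) (at z)"
      by (intro filterlim_compose[OF limH] qz)
    moreover have "((\<lambda>w. D (q * w)) \<longlongrightarrow> - z * H z) (at z)"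
    proof (rule Lim_transform_eventually)
      show "((\<lambda>w. - w * D w) \<longlongrightarrow> - z * H z) (at z)"
        by (intro tendsto_intros limH z)
      obtain h where "ext h z" using ext1[OF z] by blast
      then have "\<forall>\<^sub>F w in at z. good w" by (simp add: ext_def)
      moreover have "\<forall>\<^sub>F w in at z. w \<noteq> 0"
        using t1_space_nhds[OF z(1)] by (simp add: eventually_nhds_conv_at)
      ultimately show "\<forall>\<^sub>F w in at z. - w * D w = D (q * w)"
        by eventually_elim (simp add: shift)
    qed
    ultimately show ?thesis
      by (rule LIM_unique)
  qed
  define K where "K = cball 0 1 - ball (0::complex) (norm q)"
  have "z \<noteq> 0 \<and> norm z \<le> 1" if "z \<in> K" for z
    using that q by (auto simp: K_def)
  then have "H analytic_on K"
    using analytic near by (subst analytic_on_analytic_at) blast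
  then have "continuous_on K H"
    by (intro holomorphic_on_imp_continuous_on analytic_imp_holomorphic)
  moreover have "compact K"
    unfolding K_def by (intro compact_diff) auto
  ultimately have "bounded (H ` K)"
    by (intro compact_imp_bounded compact_continuous_image)
  then obtain M where M: "\<And>u. u \<in> K \<Longrightarrow> norm (H u) \<le> M"
    by (auto simp: bounded_iff)
  have bdd: "norm (H z) \<le> M" if z: "z \<noteq> 0" "norm z \<le> 1" for z
  proof -
    obtain n u where u: "z = q ^ n * u" "norm q < norm u" "norm u \<le> 1"
      using fundamental_annulus[OF q z] .
    have u0: "u \<noteq> 0" using u by auto
    \<comment> \<open>Inside the closed unit disc the multiplier has modulus at most 1, so the bound
      on the compact annulus \<open>K\<close> persists inwards.\<close>
    have "norm (H (q ^ k * u)) \<le> M" for k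
    proof (induction k)
      case 0
      then show ?case using M u by (simp add: K_def)
    next
      case (Suc k)
      have le: "norm (q ^ k * u) \<le> 1"
        using q u(3) by (simp add: norm_mult norm_power mult_le_one power_le_one)
      have "H (q * (q ^ k * u)) = - (q ^ k * u) * H (q ^ k * u)"
        using q u0 le by (intro shiftH near) auto
      then have "norm (H (q ^ Suc k * u)) = norm (q ^ k * u) * norm (H (q ^ k * u))"
        by (simp add: norm_mult mult.assoc)
      also have "\<dots> \<le> norm (H (q ^ k * u))"
        using le by (intro mult_left_le_one_le) auto
      finally show ?case using Suc.IH by simp
    qed
    then show ?thesis using u by simp
  qed
  have H0: "H z = 0" if "z \<noteq> 0" "norm z < 1" for z
  proof (rule q_difference_zero_disc[where M = M, OF q _ _ _ that])
    have "H analytic_on ball 0 1 - {0}"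
      using analytic near by (subst analytic_on_analytic_at) auto
    then show "H holomorphic_on ball 0 1 - {0}"
      by (rule analytic_imp_holomorphic)
  qed (use bdd shiftH near in auto)
  \<comment> \<open>The point \<open>a\<close> may lie anywhere. It is moved into the unit disc,
    where \<open>D\<close> vanishes, and the zero is carried back because the multipliers are
    nonzero.\<close>
  have good_pow: "good (q ^ n * a)" for n
    by (induction n) (use good_shift[of "q ^ n * a" for n] a q in \<open>auto simp: mult.assoc\<close>)
  obtain n where n: "norm q ^ n < 1 / norm a"
    using real_arch_pow_inv[of "1 / norm a" "norm q"] q a by auto
  then have n: "norm (q ^ n * a) < 1"
    using a by (simp add: norm_mult norm_power field_simps)
  then obtain h where h: "ext h (q ^ n * a)"
    using ext1 near q a by (metis less_imp_le mult_eq_0_iff power_not_zero)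
  \<comment> \<open>The filter \<open>nhds\<close> in \<open>ext\<close> includes the centre, so at
    a good point the value of \<open>D\<close> itself, not only its limit, is that of
    \<open>h\<close>.\<close>
  then have "D (q ^ n * a) = h (q ^ n * a)"
    using good_pow[of n] eventually_nhds_x_imp_x unfolding ext_def by blast
  also have "\<dots> = 0"
    using HI[OF h] H0 n q a by simp
  finally have "D (q ^ n * a) = 0" .
  then show ?thesis
  proof (induction n)
    case (Suc n)
    have "D (q * (q ^ n * a)) = - (q ^ n * a) * D (q ^ n * a)"
      using shift good_pow q a by simp
    then show ?case using Suc q a by (simp add: mult.assoc)
  qed simp
qed

section \<open>Cancellation of the poles\<close>

lemma jtheta_mult_minus:
  assumes "norm q < 1"
  shows "jtheta x q * jtheta (- x) q = jtheta (x\<^sup>2) (q\<^sup>2) * (Jprod 1 q)\<^sup>2 / Jprod 2 q"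
proof -
  have "jtheta x q * jtheta (- x) q =
      (qpoch_inf x q * qpoch_inf (- x) q) * (qpoch_inf (q / x) q * qpoch_inf (- (q / x)) q) * (Jprod 1 q)\<^sup>2"
    by (simp add: jtheta_def Jprod_def power2_eq_square)
  also have "\<dots> = qpoch_inf (x\<^sup>2) (q\<^sup>2) * qpoch_inf (q\<^sup>2 / x\<^sup>2) (q\<^sup>2) * (Jprod 1 q)\<^sup>2"
    by (simp only: qpoch_inf_mult_minus[OF assms] power_divide)
  also have "\<dots> = jtheta (x\<^sup>2) (q\<^sup>2) * (Jprod 1 q)\<^sup>2 / Jprod 2 q"
    using Jprod_nonzero[OF assms, of 2] unfolding jtheta_def Jprod_def[of 2] by simp
  finally show ?thesis .
qed

lemma Jprod_square: "Jprod m (q\<^sup>2) = Jprod (2 * m) q"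
  by (simp add: Jprod_def power_mult)

text \<open>Two uses of \<open>jtheta_mult_minus\<close>. The factor \<open>jtheta x q\<close>
  cancels against the numerator of the theta quotient; the other two theta factors account for the
  poles at -1 and at i, -i.\<close>

lemma jtheta_power4:
  assumes q: "norm q < 1"
  shows "jtheta (x ^ 4) (q ^ 4) =
    jtheta x q * jtheta (- x) q * jtheta (- x\<^sup>2) (q\<^sup>2) * (Jprod 4 q / (Jprod 2 q * (Jprod 1 q)\<^sup>2))"
proof -
  have q2: "norm (q\<^sup>2) < 1" using q by (simp add: norm_power_less_one)
  have J: "Jprod 1 q \<noteq> 0" "Jprod 2 q \<noteq> 0" "Jprod 4 q \<noteq> 0"
    using Jprod_nonzero[OF q] by auto
  have "jtheta (x\<^sup>2) (q\<^sup>2) = jtheta x q * jtheta (- x) q * Jprod 2 q / (Jprod 1 q)\<^sup>2"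
    using J by (simp add: jtheta_mult_minus[OF q])
  moreover have "jtheta (x ^ 4) (q ^ 4) = jtheta (x\<^sup>2) (q\<^sup>2) * jtheta (- x\<^sup>2) (q\<^sup>2) * Jprod 4 q / (Jprod 2 q)\<^sup>2"
    using jtheta_mult_minus[OF q2, of "x\<^sup>2"] J by (simp add: Jprod_square flip: power_mult)
  ultimately show ?thesis
    using J by (simp add: power2_eq_square ac_simps)
qed

text \<open>This excludes the points c q^k with c^4 = 1, the zeros of j(a^4;q^4). The poles of both
  Appell-Lerch sums are among them, and the condition is invariant under multiplication by
  q.\<close>

definition generic :: "complex \<Rightarrow> complex \<Rightarrow> bool" where
  "generic q a \<longleftrightarrow> (\<forall>k::int. a ^ 4 \<noteq> (q ^ 4) powi k)"

lemma generic_shift: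
  assumes "q \<noteq> 0"
  shows "generic q (q * a) \<longleftrightarrow> generic q a"
proof -
  have "(q * a) ^ 4 = (q ^ 4) powi k \<longleftrightarrow> a ^ 4 = (q ^ 4) powi (k - 1)" for k :: int
    using assms by (simp add: power_mult_distrib power_int_diff field_simps)
  moreover have "(\<forall>k. P (k - 1)) \<longleftrightarrow> (\<forall>k. P k)" for P :: "int \<Rightarrow> bool"
    by (metis add_diff_cancel_right')
  ultimately show ?thesis
    unfolding generic_def by simp
qed

lemma generic_power_ne:
  assumes "generic q a" "c ^ 4 = 1"
  shows "a \<noteq> c * q powi k"
proof
  assume "a = c * q powi k"
  then have "a ^ 4 = (q powi k) ^ 4" using assms(2) by (simp add: power_mult_distrib)
  also have "\<dots> = (q ^ 4) powi k"
    by (metis power_int_mult power_int_of_nat mult.commute)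
  finally show False using assms(1) unfolding generic_def by blast
qed

lemma generic_lerch:
  assumes "generic q a" "q \<noteq> 0"
  shows "1 + q powi s * a \<noteq> 0" "1 + (q\<^sup>2) powi s * a\<^sup>2 \<noteq> 0"
proof -
  have "a = - 1 * q powi (- s)" if "1 + q powi s * a = 0"
    using that assms(2) by (simp add: power_int_minus field_simps eq_neg_iff_add_eq_0)
  then show "1 + q powi s * a \<noteq> 0"
    using generic_power_ne[OF assms(1), of "- 1" "- s"] by auto
  show "1 + (q\<^sup>2) powi s * a\<^sup>2 \<noteq> 0"
  proof
    assume "1 + (q\<^sup>2) powi s * a\<^sup>2 = 0"
    moreover have e: "(q\<^sup>2) powi s = (q powi s)\<^sup>2"
      by (metis power_int_mult power_int_of_nat mult.commute)
    ultimately have "(q powi s * a)\<^sup>2 = - 1"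
      by (simp add: power_mult_distrib eq_neg_iff_add_eq_0 add.commute)
    then have c: "(q powi s * a) ^ 4 = 1"
      using power_mult[of "q powi s * a" 2 2] by simp
    have "a = (q powi s * a) * q powi (- s)"
      using assms(2) by (simp add: power_int_minus)
    with generic_power_ne[OF assms(1) c] show False by blast
  qed
qed

lemma jtheta_power4_nonzero:
  assumes "norm q < 1" "q \<noteq> 0" "a \<noteq> 0" "generic q a"
  shows "jtheta (a ^ 4) (q ^ 4) \<noteq> 0"
  using assms unfolding generic_def
  by (intro jtheta_nonzero) (auto simp: norm_power_less_one)

text \<open>Taking norms in \<open>z ^ 4 = (q ^ 4) powi k\<close> gives |z| = |q|^k, and the annulus
  leaves only k = 0.\<close>

lemma generic_annulus:
  assumes q: "norm q < 1" "q \<noteq> 0" and z: "z \<in> annulus q" "z ^ 4 \<noteq> 1"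
  shows "generic q z"
  unfolding generic_def
proof safe
  fix k :: int assume k: "z ^ 4 = (q ^ 4) powi k"
  have z0: "0 < norm z" using annulus_nonzero[OF z(1)] by simp
  have "norm z ^ 4 = (norm q ^ 4) powi k"
    using arg_cong[OF k, of norm] by (simp add: norm_power norm_power_int)
  also have "\<dots> = (norm q powi k) ^ 4"
    by (metis power_int_mult power_int_of_nat mult.commute)
  finally have nz: "norm z = norm q powi k"
    by (rule power_eq_imp_eq_base) (auto simp: zero_le_power_int)
  have "k < 1"
  proof (rule ccontr)
    assume "\<not> k < 1"
    then have "norm q powi k \<le> norm q powi 1"
      using q by (intro power_int_decreasing) auto
    then show False using nz z(1) by (simp add: annulus_def)
  qed
  moreover have "- 1 < k"
  proof (rule ccontr)
    assume "\<not> - 1 < k"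
    then have "norm q powi (- 1) \<le> norm q powi k"
      using q by (intro power_int_decreasing) auto
    then have "1 \<le> norm z * norm q"
      using nz q by (simp add: field_simps)
    then show False using z(1) by (simp add: annulus_def)
  qed
  ultimately have "k = 0" by simp
  then show False using k z(2) by simp
qed

lemma finite_fourth_roots: "finite {z::complex. z ^ 4 = 1}"
  by (rule finite_roots_unity) simp

lemma qpoch_inf_nonzero_disc:
  assumes "norm q < 1" "norm x < 1"
  shows "qpoch_inf x q \<noteq> 0"
proof (rule qpoch_inf_nonzero[OF assms(1)])
  fix i
  have "norm (x * q ^ i) \<le> norm x"
    using assms by (simp add: norm_mult norm_power mult_left_le power_le_one)
  then show "x * q ^ i \<noteq> 1" using assms(2) by auto
qed

lemma holomorphic_divide_root:
  assumes "f holomorphic_on S" "open S" "a \<in> S" "f a = 0"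
  obtains g where "g holomorphic_on S" "\<And>z. f z = (z - a) * g z"
proof
  show "(\<lambda>z. if z = a then deriv f a else (f z - f a) / (z - a)) holomorphic_on S"
    using assms by (intro pole_lemma) (auto simp: interior_open)
  show "f z = (z - a) * (if z = a then deriv f a else (f z - f a) / (z - a))" for z
    using assms(4) by auto
qed

section \<open>The defect and its functional equation\<close>

definition theta_part :: "complex \<Rightarrow> complex \<Rightarrow> complex" where
  "theta_part q a = a * (Jprod 4 q ^ 3 / Jprod 2 q ^ 3)
          * (jtheta a q * jtheta (q * a ^ 2) (q ^ 2) / jtheta (a ^ 4) (q ^ 4))"

definition defect :: "complex \<Rightarrow> complex \<Rightarrow> complex" where
  "defect q a = mock q a + appell_m a q (- 1)
     - jtheta (- a) q / jtheta q (q\<^sup>2) * appell_m (a\<^sup>2) (q\<^sup>2) (- 1) + theta_part q a"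

lemma jtheta_minus_one_nonzero:
  assumes "norm q < 1"
  shows "jtheta (- 1) q \<noteq> 0"
  using Jprod_nonzero[OF assms] by (simp add: jtheta_minus_one[OF assms])

lemma appell_shift:
  assumes q: "norm q < 1" "q \<noteq> 0" and x: "x \<noteq> 0" "\<And>s::int. 1 + q powi s * x \<noteq> 0"
  shows "appell_m (q * x) q (- 1) = 1 - x * appell_m x q (- 1)"
  using jtheta_minus_one_nonzero[OF q(1)]
  by (simp add: appell_m_minus_one lerch_shift[OF assms] diff_divide_distrib)

text \<open>Replacing a by qa moves each theta function by exactly one period of its own nome: q,
  q^2 and q^4. The three multipliers and the outer factor \<open>a\<close> combine to -a.\<close>

lemma theta_part_shift:
  assumes q: "norm q < 1" "q \<noteq> 0" and a: "a \<noteq> 0"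
  shows "theta_part q (q * a) = - a * theta_part q a"
proof -
  have q': "norm (q\<^sup>2) < 1" "q\<^sup>2 \<noteq> 0" "norm (q ^ 4) < 1" "q ^ 4 \<noteq> 0"
    using q by (auto simp: norm_power_less_one)
  have 1: "jtheta (q * a) q = - jtheta a q / a"
    by (rule jtheta_shift[OF q a])
  have "q * (q * a)\<^sup>2 = q\<^sup>2 * (q * a\<^sup>2)"
    by (simp add: power_mult_distrib ac_simps)
  then have e: "jtheta (q * (q * a)\<^sup>2) (q\<^sup>2) = jtheta (q\<^sup>2 * (q * a\<^sup>2)) (q\<^sup>2)"
    by (rule arg_cong)
  have 2: "jtheta (q * (q * a)\<^sup>2) (q\<^sup>2) = - jtheta (q * a\<^sup>2) (q\<^sup>2) / (q * a\<^sup>2)"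
    unfolding e using jtheta_shift[OF q'(1,2), of "q * a\<^sup>2"] q a by simp
  have 3: "jtheta ((q * a) ^ 4) (q ^ 4) = - jtheta (a ^ 4) (q ^ 4) / a ^ 4"
    unfolding power_mult_distrib using jtheta_shift[OF q'(3,4), of "a ^ 4"] a by simp
  have "(q * a) * c * ((- u / a) * (- v / (q * a\<^sup>2)) / (- w / a ^ 4)) = - a * (a * c * (u * v / w))"
    for c u v w
    using q a by (cases "w = 0") (auto simp: field_simps power2_eq_square power4_eq_xxxx)
  then show ?thesis
    unfolding theta_part_def 1 2 3 .
qed

text \<open>The inhomogeneous parts cancel in pairs: the -1 of \<open>mock_shift\<close> against the
  1 from m(a,q,-1), and its theta quotient against the 1 from m(a^2,q^2,-1).\<close>

lemma defect_shift:
  assumes q: "norm q < 1" "q \<noteq> 0" and a: "a \<noteq> 0" "generic q a"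
  shows "defect q (q * a) = - a * defect q a"
proof -
  have q2: "norm (q\<^sup>2) < 1" "q\<^sup>2 \<noteq> 0"
    using q by (auto simp: norm_power_less_one)
  have 1: "appell_m (q * a) q (- 1) = 1 - a * appell_m a q (- 1)"
    using generic_lerch[OF a(2) q(2)] by (intro appell_shift q a) auto
  have 2: "appell_m ((q * a)\<^sup>2) (q\<^sup>2) (- 1) = 1 - a\<^sup>2 * appell_m (a\<^sup>2) (q\<^sup>2) (- 1)"
    unfolding power_mult_distrib using generic_lerch[OF a(2) q(2)] a by (intro appell_shift q2) auto
  have 3: "jtheta (- (q * a)) q = jtheta (- a) q / a"
    using jtheta_shift[OF q, of "- a"] a by simp
  have 4: "jtheta q (q\<^sup>2) \<noteq> 0"
    using Jprod_nonzero[OF q(1)] by (simp add: jtheta_q_q2[OF q])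
  have "- 1 + j / (a * c) - a * x + (1 - a * y) - j / a / c * (1 - a\<^sup>2 * z) + - a * w =
      - a * (x + y - j / c * z + w)" if "c \<noteq> 0" for j c x y z w
    using that a by (simp add: field_simps power2_eq_square)
  from this[OF 4] show ?thesis
    unfolding defect_def mock_shift[OF q a(1)] theta_part_shift[OF q a(1)] 1 2 3 .
qed

text \<open>The theta function j(-z;q) with its zero at -1 divided out. It has no zeros on the
  annulus, so it can stand in denominators, and its values enter the residues.\<close>

definition theta_reg :: "complex \<Rightarrow> complex \<Rightarrow> complex" where
  "theta_reg q z = qpoch_inf (- z * q) q * qpoch_inf (- q / z) q * Jprod 1 q"

lemma jtheta_minus_theta_reg:
  assumes "norm q < 1"
  shows "jtheta (- z) q = (1 + z) * theta_reg q z"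
  using qpoch_inf_shift[OF assms, of "- z"] by (simp add: jtheta_def theta_reg_def Jprod_def)

lemma theta_reg_nonzero:
  assumes "norm q < 1" "z \<in> annulus q"
  shows "theta_reg q z \<noteq> 0"
proof -
  have "norm (- z * q) < 1" "norm (- q / z) < 1"
    using assms(2) annulus_nonzero[OF assms(2)] by (auto simp: annulus_def norm_mult norm_divide)
  then show ?thesis
    using assms(1) Jprod_nonzero[OF assms(1)] by (simp add: theta_reg_def qpoch_inf_nonzero_disc del: mult_minus_left)
qed

lemma holomorphic_theta_reg [holomorphic_intros]:
  assumes "norm q < 1" "f holomorphic_on S" "\<And>z. z \<in> S \<Longrightarrow> f z \<noteq> 0"
  shows "(\<lambda>z. theta_reg q (f z)) holomorphic_on S"
  unfolding theta_reg_def by (intro holomorphic_intros assms)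

lemma holomorphic_jtheta [holomorphic_intros]:
  assumes "norm q < 1" "f holomorphic_on S" "\<And>z. z \<in> S \<Longrightarrow> f z \<noteq> 0"
  shows "(\<lambda>z. jtheta (f z) q) holomorphic_on S"
  unfolding jtheta_def by (intro holomorphic_intros assms)

lemma annulus_square:
  assumes "norm q < 1" "z \<in> annulus q"
  shows "z\<^sup>2 \<in> annulus (q\<^sup>2)"
proof -
  have "norm q ^ 2 < norm z ^ 2" "(norm z * norm q) ^ 2 < 1"
    using assms by (auto simp: annulus_def power_less_one_iff intro!: power_strict_mono)
  then show ?thesis
    by (simp add: annulus_def norm_power power_mult_distrib)
qed

text \<open>All singularities in the annulus are now visible in \<open>1 + z\<close> and
  \<open>1 + z\<^sup>2\<close>. The constant is (J_4/J_2)^3 divided by the J_4/(J_2 J_1^2) of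
  \<open>jtheta_power4\<close>.\<close>

lemma theta_part_factored:
  assumes q: "norm q < 1" "q \<noteq> 0" and z: "z \<noteq> 0" "generic q z"
  shows "theta_part q z = ((Jprod 4 q)\<^sup>2 * (Jprod 1 q)\<^sup>2 / (Jprod 2 q)\<^sup>2) * z * jtheta (q * z\<^sup>2) (q\<^sup>2) /
    ((1 + z) * theta_reg q z * ((1 + z\<^sup>2) * theta_reg (q\<^sup>2) (z\<^sup>2)))"
proof -
  have q2: "norm (q\<^sup>2) < 1"
    using q by (auto simp: norm_power_less_one)
  have J: "Jprod 1 q \<noteq> 0" "Jprod 2 q \<noteq> 0" "Jprod 4 q \<noteq> 0"
    using Jprod_nonzero[OF q(1)] by auto
  have t: "jtheta z q \<noteq> 0"
    using jtheta_power4_nonzero[OF q z] unfolding jtheta_power4[OF q(1)] by auto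
  have cancel: "x * (e ^ 3 / d ^ 3) * (t * w / (t * A * B * (e / (d * c\<^sup>2)))) = (e\<^sup>2 * c\<^sup>2 / d\<^sup>2) * x * w / (A * B)"
    if "t \<noteq> 0" "c \<noteq> 0" "d \<noteq> 0" "e \<noteq> 0" for x e d t w A B c :: complex
    using that by (simp add: power2_eq_square power3_eq_cube ac_simps)
  show ?thesis
    unfolding theta_part_def jtheta_power4[OF q(1)] cancel[OF t J]
    by (simp only: jtheta_minus_theta_reg[OF q(1)] jtheta_minus_theta_reg[OF q2])
qed

text \<open>The values that enter at the poles. At z = i and z = -i one has -1/z = z, so the two
  products in \<open>theta_reg\<close> have opposite arguments and merge into one with base q^2; the
  value of j(-q;q^2) comes from separating odd and even exponents in (-q;q).\<close>

lemma theta_values: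
  assumes q: "norm q < 1" "q \<noteq> 0"
  shows "theta_reg q (- 1) = Jprod 1 q ^ 3"
    and "theta_reg q 1 = (Jprod 2 q)\<^sup>2 / Jprod 1 q"
    and "z\<^sup>2 = - 1 \<Longrightarrow> theta_reg q z = Jprod 4 q * Jprod 1 q / Jprod 2 q"
    and "jtheta (- q) (q\<^sup>2) = Jprod 2 q ^ 5 / ((Jprod 1 q)\<^sup>2 * (Jprod 4 q)\<^sup>2)"
proof -
  have q2: "norm (q\<^sup>2) < 1"
    using q by (auto simp: norm_power_less_one)
  have J: "Jprod 1 q \<noteq> 0" "Jprod 2 q \<noteq> 0" "Jprod 4 q \<noteq> 0"
    using Jprod_nonzero[OF q(1)] by auto
  have mq2: "qpoch_inf (- q\<^sup>2) (q\<^sup>2) = Jprod 4 q / Jprod 2 q"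
    using qpoch_inf_minus_q[OF q2] by (simp add: Jprod_square)
  show "theta_reg q (- 1) = Jprod 1 q ^ 3"
    by (simp add: theta_reg_def Jprod_def power3_eq_cube)
  show "theta_reg q 1 = (Jprod 2 q)\<^sup>2 / Jprod 1 q"
    using J by (simp add: theta_reg_def qpoch_inf_minus_q[OF q(1)] power2_eq_square)
  show "theta_reg q z = Jprod 4 q * Jprod 1 q / Jprod 2 q" if z: "z\<^sup>2 = - 1"
  proof -
    have "- 1 / z = z"
      using z by (cases "z = 0") (auto simp: power2_eq_square field_simps)
    then have "- q / z = z * q" by (metis mult.commute mult_minus1_right times_divide_eq_right)
    moreover have "qpoch_inf (z * q) q * qpoch_inf (- (z * q)) q = qpoch_inf (- q\<^sup>2) (q\<^sup>2)"
      unfolding qpoch_inf_mult_minus[OF q(1)] power_mult_distrib z by simp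
    ultimately show ?thesis
      by (simp add: theta_reg_def mq2 ac_simps)
  qed
  have e: "- q * q = - q\<^sup>2" "q\<^sup>2 / - q = - q"
    using q by (simp_all add: power2_eq_square)
  then have "Jprod 2 q / Jprod 1 q = qpoch_inf (- q) (q\<^sup>2) * (Jprod 4 q / Jprod 2 q)"
    using qpoch_inf_double[OF q(1), of "- q"] by (simp add: qpoch_inf_minus_q[OF q(1)] mq2)
  then have m: "qpoch_inf (- q) (q\<^sup>2) = (Jprod 2 q)\<^sup>2 / (Jprod 1 q * Jprod 4 q)"
    using J by (simp add: field_simps power2_eq_square)
  show "jtheta (- q) (q\<^sup>2) = Jprod 2 q ^ 5 / ((Jprod 1 q)\<^sup>2 * (Jprod 4 q)\<^sup>2)"
    unfolding jtheta_def e m Jprod_def[of 2, symmetric]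
    by (simp add: power2_eq_square power_numeral_reduce ac_simps)
qed

text \<open>On the annulus the singular part of the defect is
  \<open>N z / ((1 + z) * (1 + z\<^sup>2))\<close>, and \<open>N\<close> vanishes at the three poles.\<close>

lemma defect_regular:
  assumes q: "norm q < 1" "q \<noteq> 0"
  obtains g where "g holomorphic_on annulus q"
    "\<And>z. z \<in> annulus q \<Longrightarrow> generic q z \<Longrightarrow> defect q z = g z"
proof -
  have q2: "norm (q\<^sup>2) < 1" "q\<^sup>2 \<noteq> 0"
    using q by (auto simp: norm_power_less_one)
  obtain g1 where g1: "g1 holomorphic_on annulus q" "\<And>x. x \<noteq> 0 \<Longrightarrow> lerch q x = 1 / (1 + x) + g1 x"
    using lerch_regular_part[OF q] by blast
  obtain g2 where g2: "g2 holomorphic_on annulus (q\<^sup>2)" "\<And>x. x \<noteq> 0 \<Longrightarrow> lerch (q\<^sup>2) x = 1 / (1 + x) + g2 x"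
    using lerch_regular_part[OF q2] by blast
  define j1 j2 J K where "j1 = jtheta (- 1) q" and "j2 = jtheta (- 1) (q\<^sup>2)" and "J = jtheta q (q\<^sup>2)"
    and "K = (Jprod 4 q)\<^sup>2 * (Jprod 1 q)\<^sup>2 / (Jprod 2 q)\<^sup>2"
  define u v w where "u = theta_reg q" and "v z = theta_reg (q\<^sup>2) (z\<^sup>2)" and "w z = jtheta (q * z\<^sup>2) (q\<^sup>2)" for z
  define N where "N z = (1 + z\<^sup>2) / j1 - (1 + z)\<^sup>2 * u z / (J * j2) + K * z * w z / (u z * v z)" for z
  define A where "A = annulus q"
  have J: "Jprod 1 q \<noteq> 0" "Jprod 2 q \<noteq> 0" "Jprod 4 q \<noteq> 0"
    using Jprod_nonzero[OF q(1)] by auto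
  have vals: "j1 = 2 * (Jprod 2 q)\<^sup>2 / Jprod 1 q" "j2 = 2 * (Jprod 4 q)\<^sup>2 / Jprod 2 q"
      "J = (Jprod 1 q)\<^sup>2 / Jprod 2 q"
    unfolding j1_def j2_def J_def
    using jtheta_minus_one[OF q(1)] jtheta_minus_one[OF q2(1)] jtheta_q_q2[OF q] by (simp_all add: Jprod_square)
  have A0: "z \<noteq> 0" if "z \<in> A" for z using that annulus_nonzero by (auto simp: A_def)
  have u: "u z \<noteq> 0" if "z \<in> A" for z
    using that theta_reg_nonzero[OF q(1)] by (simp add: u_def A_def)
  have v: "v z \<noteq> 0" if "z \<in> A" for z
    using that theta_reg_nonzero[OF q2(1) annulus_square[OF q(1)]] by (simp add: v_def A_def)
  have hol: "u holomorphic_on A" "v holomorphic_on A" "w holomorphic_on A"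
    unfolding u_def v_def[abs_def] w_def[abs_def] using q q2 A0
    by (auto intro!: holomorphic_intros holomorphic_theta_reg[where f = "\<lambda>z. z", simplified])
  have N: "N holomorphic_on A"
    unfolding N_def[abs_def] using u v vals J by (intro holomorphic_intros hol) auto
  have openA: "open A" by (simp add: A_def open_annulus)
  have inA: "- 1 \<in> A" "\<i> \<in> A" "- \<i> \<in> A"
    using q by (auto simp: A_def annulus_def)
  \<comment> \<open>The middle term vanishes here, so m(a,q,-1) is balanced by the theta quotient;
    both contributions equal J_1/J_2^2 up to sign.\<close>
  have N1: "N (- 1) = 0"
  proof -
    have uvw: "u (- 1) = Jprod 1 q ^ 3" "v (- 1) = (Jprod 4 q)\<^sup>2 / Jprod 2 q" "w (- 1) = J"
      using theta_values(1)[OF q] theta_values(2)[OF q2] by (simp_all add: u_def v_def w_def J_def Jprod_square)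
    show ?thesis
      unfolding N_def K_def uvw vals using J by (simp add: field_simps power2_eq_square power3_eq_cube)
  qed
  \<comment> \<open>Now the first term vanishes and \<open>(1 + z)\<^sup>2 = 2 * z\<close>, so the
    other two are multiples of \<open>z\<close> with constant coefficients, and one computation
    covers i and -i.\<close>
  have Ni: "N z = 0" if z: "z\<^sup>2 = - 1" for z
  proof -
    have uvw: "u z = Jprod 4 q * Jprod 1 q / Jprod 2 q" "v z = Jprod 2 q ^ 3"
        "w z = Jprod 2 q ^ 5 / ((Jprod 1 q)\<^sup>2 * (Jprod 4 q)\<^sup>2)"
      using theta_values(3)[OF q z] theta_values(1)[OF q2] theta_values(4)[OF q] z
      by (simp_all add: u_def v_def w_def Jprod_square)
    have z1: "(1 + z)\<^sup>2 = 2 * z" using z by (simp add: power2_sum)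
    show ?thesis
      unfolding N_def K_def uvw vals z z1 using J
      by (simp add: field_simps power2_eq_square power_numeral_reduce)
  qed
  \<comment> \<open>The three roots are distinct, so they can be divided out one after another, each
    quotient still vanishing at the remaining roots.\<close>
  obtain f1 where f1: "f1 holomorphic_on A" "\<And>z. N z = (z - (- 1)) * f1 z"
    using holomorphic_divide_root[OF N openA inA(1) N1] by blast
  have i: "\<i> + 1 \<noteq> 0" "- \<i> + 1 \<noteq> 0" "\<i> \<noteq> - \<i>"
    by (auto simp: complex_eq_iff)
  have "f1 \<i> = 0" "f1 (- \<i>) = 0"
    using f1(2)[of \<i>] f1(2)[of "- \<i>"] Ni[of \<i>] Ni[of "- \<i>"] i by auto
  then obtain f2 where f2: "f2 holomorphic_on A" "\<And>z. f1 z = (z - \<i>) * f2 z"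
    using holomorphic_divide_root[OF f1(1) openA inA(2)] by blast
  have "f2 (- \<i>) = 0"
    using f2(2)[of "- \<i>"] \<open>f1 (- \<i>) = 0\<close> i by auto
  then obtain f3 where f3: "f3 holomorphic_on A" "\<And>z. f2 z = (z - (- \<i>)) * f3 z"
    using holomorphic_divide_root[OF f2(1) openA inA(3)] by blast
  have Nf: "N z = (1 + z) * (1 + z\<^sup>2) * f3 z" for z
    unfolding f1(2) f2(2) f3(2) by (simp add: algebra_simps power2_eq_square)
  define g where "g z = mock q z + g1 z / j1 - (1 + z) * u z * g2 (z\<^sup>2) / (J * j2) + f3 z" for z
  have "(\<lambda>z. g2 (z\<^sup>2)) holomorphic_on A"
  proof -
    have "(\<lambda>z. z\<^sup>2) holomorphic_on A"
      by (intro holomorphic_intros)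
    moreover have "(\<lambda>z. z\<^sup>2) ` A \<subseteq> annulus (q\<^sup>2)"
      using annulus_square[OF q(1)] by (auto simp: A_def)
    ultimately show ?thesis
      using holomorphic_on_compose_gen[OF _ g2(1)] by (auto simp: o_def)
  qed
  moreover have "mock q holomorphic_on A"
    using A0 by (intro holomorphic_on_subset[OF holomorphic_mock[OF q(1)]]) auto
  ultimately have "g holomorphic_on A"
    unfolding g_def[abs_def] using g1(1) f3(1) vals J by (intro holomorphic_intros hol) (auto simp: A_def)
  moreover have "defect q z = g z" if z: "z \<in> A" "generic q z" for z
  proof -
    have ne: "1 + z \<noteq> 0" "1 + z\<^sup>2 \<noteq> 0"
      using generic_lerch[OF z(2) q(2), of 0] by auto
    have jj: "j1 \<noteq> 0" "j2 \<noteq> 0" "J \<noteq> 0"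
      using J by (auto simp: vals)
    have z2: "z\<^sup>2 \<noteq> 0" using A0[OF z(1)] by simp
    have "f3 z = N z / ((1 + z) * (1 + z\<^sup>2))"
      using Nf[of z] ne by simp
    also have "\<dots> = 1 / (1 + z) / j1 - (1 + z) * u z / J * (1 / (1 + z\<^sup>2) / j2)
        + K * z * w z / ((1 + z) * u z * ((1 + z\<^sup>2) * v z))"
    proof -
      have "((b / j1 - a\<^sup>2 * U / (J * j2) + Z / (U * V)) / (a * b)) =
          1 / a / j1 - a * U / J * (1 / b / j2) + Z / (a * U * (b * V))"
        if "a \<noteq> 0" "b \<noteq> 0" "U \<noteq> 0" "V \<noteq> 0" for a b U V Z
        using that jj by (simp add: field_simps power2_eq_square)
      from this[OF ne u[OF z(1)] v[OF z(1)]] show ?thesis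
        unfolding N_def .
    qed
    finally have f3: "f3 z = \<dots>" .
    have t: "theta_part q z = K * z * w z / ((1 + z) * u z * ((1 + z\<^sup>2) * v z))"
      unfolding theta_part_factored[OF q A0[OF z(1)] z(2)] K_def w_def u_def v_def ..
    have "defect q z = mock q z + (1 / (1 + z) + g1 z) / j1
        - (1 + z) * u z / J * ((1 / (1 + z\<^sup>2) + g2 (z\<^sup>2)) / j2) + theta_part q z"
      unfolding defect_def appell_m_minus_one g1(2)[OF A0[OF z(1)]] g2(2)[OF z2]
      by (simp add: j1_def j2_def J_def u_def jtheta_minus_theta_reg[OF q(1)])
    also have "\<dots> = g z"
      unfolding t g_def f3 by (simp add: add_divide_distrib ring_distribs)
    finally show ?thesis .
  qed
  ultimately show ?thesis
    using that by (simp add: A_def)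
qed

lemma eventually_generic:
  assumes q: "norm q < 1" "q \<noteq> 0" and z: "z \<in> annulus q"
  shows "\<forall>\<^sub>F w in at z. generic q w"
proof -
  have "\<forall>\<^sub>F w in at z. w \<in> annulus q"
    using eventually_nhds_in_open[OF open_annulus z] by (simp add: eventually_nhds_conv_at)
  moreover have "\<forall>\<^sub>F w in at z. w \<notin> {w. w ^ 4 = 1}"
    using finite_fourth_roots by (metis islimpt_finite islimpt_iff_eventually)
  ultimately show ?thesis
    by eventually_elim (use generic_annulus[OF q] in auto)
qed

theorem theorem4p4:
  fixes q a :: complex
  assumes "0 < norm q" and "norm q < 1"
    and "a \<noteq> 0"
    and "\<And>k::int. a ^ 4 \<noteq> (q ^ 4) powi k"
  shows "(1 + 1 / a) *
      (\<Sum>n. qpoch (- a * q) q n * qpoch (- q / a) q n * q ^ (n + 1) / qpoch q (q ^ 2) (n + 1))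
    = - appell_m a q (-1)
      + jtheta (- a) q / jtheta q (q ^ 2) * appell_m (a ^ 2) (q ^ 2) (-1)
      - a * (Jprod 4 q ^ 3 / Jprod 2 q ^ 3)
          * (jtheta a q * jtheta (q * a ^ 2) (q ^ 2) / jtheta (a ^ 4) (q ^ 4))"
proof -
  have q: "norm q < 1" "q \<noteq> 0" using assms by auto
  have a: "generic q a" using assms(4) by (simp add: generic_def)
  obtain g where g: "g holomorphic_on annulus q"
    "\<And>z. z \<in> annulus q \<Longrightarrow> generic q z \<Longrightarrow> defect q z = g z"
    using defect_regular[OF q] by blast
  have "defect q a = 0"
    by (rule q_difference_zero[OF q generic_shift defect_shift g(1) eventually_generic g(2) assms(3) a])
       (use q in auto)
  then show ?thesis
    unfolding defect_def mock_def theta_part_def by (simp add: algebra_simps)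
qed

end
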